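(* Consider the $K$-armed Gaussian bandit with known heterogeneous reward variances described in the context, with prior parameters $\mu_{0,i}\in\mathbb{R}$, $\sigma_{0,i}>0$ and known reward variances $\sigma_i^2>0$ for $i\in[K]$, and let $A_t$ be the arm pulled in round $t$ by Gaussian Thompson sampling (Algorithm 1). Then for every horizon $n\ge 1$ and every $\delta\in(0,1)$, the $n$-round Bayes regret satisfies \[ R_n=\mathbb{E}\Big[\sum_{t=1}^n (\mu_{A^*}-\mu_{A_t})\Big] \le \sqrt{2n\log(1/\delta)\sum_{i=1}^K \sigma_i^2\log\!\Big(1+\frac{n\,\sigma_{0,i}^2}{\sigma_i^2}\Big)} +\sqrt{2n\log(1/\delta)\sum_{i=1}^K\sigma_{0,i}^2} + n\delta\sum_{i=1}^K\sqrt{\frac{2\sigma_{0,i}^2}{\pi}}\,. \]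
   Context: Bandit model: there are $K$ arms. The mean rewards are drawn independently as $\mu_i\sim\mathcal N(\mu_{0,i},\sigma_{0,i}^2)$, $i\in[K]$, where $\mu_{0,i},\sigma_{0,i}^2$ are known to the agent. In round $t\in[n]$ the agent pulls an arm $A_t\in[K]$ and observes $x_{t,A_t}\sim\mathcal N(\mu_{A_t},\sigma_{A_t}^2)$, independently of the past given $\mu$, where the reward variances $\sigma_i^2>0$ are known. $A^*=\arg\max_{i}\mu_i$ is the optimal arm. The expectation in $R_n$ is over the draw of $\mu$ from the prior, the reward noise and the algorithm's internal randomization. Algorithm 1 (Gaussian TS): let $N_t(i)=\sum_{s<t}\mathbf 1\{A_s=i\}$ and, in round $t$, set $\sigma_{t,i}^2=\big(\sigma_{0,i}^{-2}+N_t(i)\sigma_i^{-2}\big)^{-1}$ and $\hat\mu_{t,i}=\sigma_{t,i}^2\big(\mu_{0,i}/\sigma_{0,i}^2+\sigma_i^{-2}\sum_{s<t}\mathbf 1\{A_s=i\}x_{s,i}\big)$ (the Gaussian posterior of $\mu_i$ given the history). Sample independently $\tilde\mu_{t,i}\sim\mathcal N(\hat\mu_{t,i},\sigma_{t,i}^2)$ for all $i$, and pull $A_t=\arg\max_i\tilde\mu_{t,i}$. *)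

theory Defs
  imports "HOL-Probability.Probability"
begin

definition gauss :: "real \<Rightarrow> real \<Rightarrow> real measure" where
  "gauss m s = density lborel (normal_density m s)"

text \<open>Histories: h s = (A_s, x_{s,A_s}) for rounds s < t (rounds indexed 0,1,...).
  Entries for rounds s >= t are irrelevant (initialised to (0,0)).\<close>
definition histM :: "(nat \<Rightarrow> nat \<times> real) measure" where
  "histM = PiM UNIV (\<lambda>_. count_space UNIV \<Otimes>\<^sub>M borel)"

definition npulls :: "(nat \<Rightarrow> nat \<times> real) \<Rightarrow> nat \<Rightarrow> nat \<Rightarrow> nat" where
  "npulls h t i = card {s. s < t \<and> fst (h s) = i}"

definition post_var :: "(nat \<Rightarrow> real) \<Rightarrow> (nat \<Rightarrow> real) \<Rightarrow> (nat \<Rightarrow> nat \<times> real) \<Rightarrow> nat \<Rightarrow> nat \<Rightarrow> real" where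
  "post_var s0 sig h t i = inverse (inverse ((s0 i)\<^sup>2) + real (npulls h t i) * inverse ((sig i)\<^sup>2))"

definition post_mean :: "(nat \<Rightarrow> real) \<Rightarrow> (nat \<Rightarrow> real) \<Rightarrow> (nat \<Rightarrow> real) \<Rightarrow> (nat \<Rightarrow> nat \<times> real) \<Rightarrow> nat \<Rightarrow> nat \<Rightarrow> real" where
  "post_mean m0 s0 sig h t i = post_var s0 sig h t i *
     (m0 i / (s0 i)\<^sup>2 + inverse ((sig i)\<^sup>2) * (\<Sum>s\<in>{s. s < t \<and> fst (h s) = i}. snd (h s)))"

text \<open>argmax over arms {0..<K}; ties (a null event) broken towards the smallest index.\<close>
definition argmax_arm :: "nat \<Rightarrow> (nat \<Rightarrow> real) \<Rightarrow> nat" where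
  "argmax_arm K v = (LEAST i. i < K \<and> (\<forall>j<K. v j \<le> v i))"

definition ts_step :: "nat \<Rightarrow> (nat \<Rightarrow> real) \<Rightarrow> (nat \<Rightarrow> real) \<Rightarrow> (nat \<Rightarrow> real) \<Rightarrow> (nat \<Rightarrow> real)
     \<Rightarrow> nat \<Rightarrow> (nat \<Rightarrow> nat \<times> real) \<Rightarrow> (nat \<Rightarrow> nat \<times> real) measure" where
  "ts_step K m0 s0 sig mu t h =
     bind (PiM {..<K} (\<lambda>i. gauss (post_mean m0 s0 sig h t i) (sqrt (post_var s0 sig h t i))))
       (\<lambda>v. let a = argmax_arm K v in
            bind (gauss (mu a) (sig a)) (\<lambda>x. return histM (h(t := (a, x)))))"

fun ts_hist :: "nat \<Rightarrow> (nat \<Rightarrow> real) \<Rightarrow> (nat \<Rightarrow> real) \<Rightarrow> (nat \<Rightarrow> real) \<Rightarrow> (nat \<Rightarrow> real)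
     \<Rightarrow> nat \<Rightarrow> (nat \<Rightarrow> nat \<times> real) measure" where
  "ts_hist K m0 s0 sig mu 0 = return histM (\<lambda>_. (0, 0))"
| "ts_hist K m0 s0 sig mu (Suc t) = bind (ts_hist K m0 s0 sig mu t) (ts_step K m0 s0 sig mu t)"

definition prior :: "nat \<Rightarrow> (nat \<Rightarrow> real) \<Rightarrow> (nat \<Rightarrow> real) \<Rightarrow> (nat \<Rightarrow> real) measure" where
  "prior K m0 s0 = PiM {..<K} (\<lambda>i. gauss (m0 i) (s0 i))"

definition bayes_regret :: "nat \<Rightarrow> (nat \<Rightarrow> real) \<Rightarrow> (nat \<Rightarrow> real) \<Rightarrow> (nat \<Rightarrow> real) \<Rightarrow> nat \<Rightarrow> real" where
  "bayes_regret K m0 s0 sig n =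
     (\<integral>mu. (\<integral>h. (\<Sum>t<n. Max (mu ` {..<K}) - mu (fst (h t))) \<partial>ts_hist K m0 s0 sig mu n) \<partial>prior K m0 s0)"

end

theory Submission
  imports Defs
begin

text \<open>
  Given the history, the mean vector \<open>\<mu>\<close> and the Thompson sample \<open>v\<close> are independent draws from the
  same Gaussian posterior, so the expected regret of a round equals the expected excess of \<open>v\<close>
  over the posterior mean at the sampled arm. Up to the width
  \<open>sqrt (2 * ln (1 / \<delta>) * post_var)\<close> this excess is charged to that arm; what lies above contributes
  at most \<open>\<delta>\<close> times the absolute first moment, summed over all arms. The widths along the
  trajectory are summed pathwise with Cauchy-Schwarz:
  the posterior variances of the pulled arms add up to a logarithmic potential.

  Everything is done with nonnegative integrals, which avoids proving integrability of the regret: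
  a Bochner integral is bounded by the nonnegative integral even when it has the junk value 0.
\<close>

section \<open>Gaussian measures and kernels\<close>

text \<open>That the means and the Thompson sample share a law given the history is the main work.
  Arms depend on past rewards, so the joint law of means and history is only available as a
  recursive kernel started from \<open>\<mu>\<close>. The conditional law is rebuilt along this
  recursion: within a round the sample depends on the history alone, so Fubini lets it be drawn
  before the means; the arm is then fixed and the reward triggers one conjugate update. What is left
  is a law of histories in which \<open>\<mu>\<close> no longer occurs.

  The symmetry speaks of a fresh sample \<open>v\<close>, the potential of the arms recorded in
  \<open>h\<close>. \<open>expect_Suc\<close> translates between the two and is used once in each
  direction.

  The factor \<open>sqrt (2 * ln (1 / \<delta>))\<close> is the number of standard deviations after
  which a Gaussian density has dropped by exactly the factor \<open>\<delta>\<close>. The two square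
  roots of the bound come from splitting the potential into its logarithm and the variance
  \<open>s0^2\<close> of the first pull of each arm.\<close>

lemma sets_gauss [simp, measurable_cong]: "sets (gauss m s) = sets borel"
  and space_gauss [simp]: "space (gauss m s) = UNIV"
  by (simp_all add: gauss_def)

lemma gauss_zero: "gauss m 0 = density lborel (\<lambda>_. 0)"
  by (simp add: gauss_def normal_density_def)

lemma prob_space_gauss:
  assumes "0 < s" shows "prob_space (gauss m s)"
  using prob_space_normal_density[OF assms] by (simp add: gauss_def)

lemma gauss_uminus: "gauss m (- s) = gauss m s"
  by (simp add: gauss_def normal_density_def)

text \<open>Division by zero makes \<open>gauss m 0\<close> the null measure, not a Dirac measure,
  and the density is even in \<open>s\<close>. Hence every parameter gives a subprobability, and the
  kernel lemmas below carry no positivity conditions.\<close>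

lemma subprob_space_gauss: "subprob_space (gauss m s)"
proof (cases "s = 0")
  case True
  show ?thesis
    by (rule subprob_spaceI) (simp_all add: True gauss_zero emeasure_density)
next
  case False
  then show ?thesis
    using prob_space_gauss[of s m] prob_space_gauss[of "- s" m]
    by (cases "s > 0") (auto simp: gauss_uminus intro: prob_space_imp_subprob_space)
qed

lemma sigma_finite_gauss: "sigma_finite_measure (gauss m s)"
  unfolding gauss_def 
  by (subst sigma_finite_measure.sigma_finite_iff_density_finite[OF lborel.sigma_finite_measure_axioms]) auto

lemma nn_integral_gauss:
  assumes "f \<in> borel_measurable borel"
  shows "(\<integral>\<^sup>+x. f x \<partial>gauss m s) = (\<integral>\<^sup>+x. ennreal (normal_density m s x) * f x \<partial>lborel)"
  using assms unfolding gauss_def by (subst nn_integral_density) auto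

lemma measurable_normal_density [measurable (raw)]:
  assumes [measurable]: "f \<in> borel_measurable M" "g \<in> borel_measurable M" "h \<in> borel_measurable M"
  shows "(\<lambda>x. normal_density (f x) (g x) (h x)) \<in> borel_measurable M"
  unfolding normal_density_def by measurable

lemma measurable_gauss [measurable (raw)]:
  assumes [measurable]: "f \<in> borel_measurable M" "g \<in> borel_measurable M"
  shows "(\<lambda>x. gauss (f x) (g x)) \<in> M \<rightarrow>\<^sub>M subprob_algebra borel"
proof (rule measurable_subprob_algebra)
  fix A :: "real set" assume [measurable]: "A \<in> sets borel"
  have "emeasure (gauss (f x) (g x)) A
      = (\<integral>\<^sup>+y. ennreal (normal_density (f x) (g x) y) * indicator A y \<partial>lborel)" for x
    unfolding gauss_def by (subst emeasure_density) auto
  then show "(\<lambda>x. emeasure (gauss (f x) (g x)) A) \<in> borel_measurable M"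
    by simp
qed (simp_all add: subprob_space_gauss)

lemma product_sigma_finite_gauss: "product_sigma_finite (\<lambda>i. gauss (m i) (s i))"
  by (simp add: product_sigma_finite_def sigma_finite_gauss)

lemma sets_PiM_gauss [simp, measurable_cong]:
  "sets (PiM I (\<lambda>i. gauss (m i) (s i))) = sets (PiM I (\<lambda>_. borel))"
  by (intro sets_PiM_cong) simp_all

lemma space_PiM_gauss [simp]:
  "space (PiM I (\<lambda>i. gauss (m i) (s i))) = space (PiM I (\<lambda>_. borel))"
  by (intro sets_eq_imp_space_eq) simp

text \<open>Rectangles form an intersection-stable generator, and on them the product measure is a
  finite product of one-dimensional measures, each measurable in the parameters.\<close>

lemma measurable_PiM_gauss:
  assumes I: "finite I"
    and [measurable]: "\<And>i. i \<in> I \<Longrightarrow> (\<lambda>x. m x i) \<in> borel_measurable M"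
      "\<And>i. i \<in> I \<Longrightarrow> (\<lambda>x. s x i) \<in> borel_measurable M"
  shows "(\<lambda>x. PiM I (\<lambda>i. gauss (m x i) (s x i))) \<in> M \<rightarrow>\<^sub>M subprob_algebra (PiM I (\<lambda>_. borel))"
proof -
  have rect: "emeasure (PiM I (\<lambda>i. gauss (m x i) (s x i))) (Pi\<^sub>E I X)
      = (\<Prod>i\<in>I. emeasure (gauss (m x i) (s x i)) (X i))"
    if "\<And>i. i \<in> I \<Longrightarrow> X i \<in> sets borel" for x X
    using that I by (subst product_sigma_finite.emeasure_PiM[OF product_sigma_finite_gauss]) auto
  have rect_meas: "(\<lambda>x. emeasure (PiM I (\<lambda>i. gauss (m x i) (s x i))) (Pi\<^sub>E I X)) \<in> borel_measurable M"
    if "\<And>i. i \<in> I \<Longrightarrow> X i \<in> sets borel" for X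
    using that
    by (subst rect) (auto intro!: borel_measurable_prod_ennreal
        emeasure_measurable_subprob_algebra2[where N=borel])
  show ?thesis
  proof (rule measurable_subprob_algebra_generated[OF sets_PiM Int_stable_prod_algebra prod_algebra_sets_into_space])
    fix x
    show "subprob_space (PiM I (\<lambda>i. gauss (m x i) (s x i)))"
    proof (rule subprob_spaceI)
      have "emeasure (PiM I (\<lambda>i. gauss (m x i) (s x i))) (Pi\<^sub>E I (\<lambda>_. UNIV)) \<le> 1"
        by (subst rect) (auto intro!: prod_le_1 subprob_space.subprob_emeasure_le_1 subprob_space_gauss)
      then show "emeasure (PiM I (\<lambda>i. gauss (m x i) (s x i))) (space (PiM I (\<lambda>i. gauss (m x i) (s x i)))) \<le> 1"
        by (simp add: space_PiM)
      show "space (PiM I (\<lambda>i. gauss (m x i) (s x i))) \<noteq> {}"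
        by (simp add: space_PiM PiE_eq_empty_iff)
    qed
    show "sets (PiM I (\<lambda>i. gauss (m x i) (s x i))) = sets (PiM I (\<lambda>_. borel))" by simp
  next
    fix A :: "('a \<Rightarrow> real) set" assume "A \<in> prod_algebra I (\<lambda>_. borel)"
    then show "(\<lambda>x. emeasure (PiM I (\<lambda>i. gauss (m x i) (s x i))) A) \<in> borel_measurable M"
      using rect_meas by (auto simp: prod_algebra_eq_finite[OF I])
  next
    show "(\<lambda>x. emeasure (PiM I (\<lambda>i. gauss (m x i) (s x i))) (\<Pi>\<^sub>E i\<in>I. space borel)) \<in> borel_measurable M"
      by (rule rect_meas) simp
  qed
qed

text \<open>Outside the index set, elements of the product space take the constant value \<open>undefined\<close>.\<close>

lemma measurable_PiM_component_total:
  "(\<lambda>v. v i) \<in> borel_measurable (PiM I (\<lambda>_. borel :: real measure))"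
proof (cases "i \<in> I")
  case False
  then show ?thesis
    by (subst measurable_cong[where g="\<lambda>_. undefined"]) (auto simp: space_PiM)
qed simp

lemma measurable_argmax_arm [measurable]:
  "argmax_arm K \<in> PiM {..<K} (\<lambda>_. borel) \<rightarrow>\<^sub>M count_space UNIV"
  unfolding argmax_arm_def[abs_def]
proof (rule measurable_Least)
  fix i
  have "Measurable.pred (PiM {..<K} (\<lambda>_. borel)) (\<lambda>v. v j \<le> (v i :: real))" for j
    unfolding Measurable.pred_def
    by (intro borel_measurable_le measurable_PiM_component_total)
  then show "Measurable.pred (PiM {..<K} (\<lambda>_. borel)) (\<lambda>v. i < K \<and> (\<forall>j<K. v j \<le> (v i :: real)))"
    by (intro pred_intros_logic pred_intros_countable) auto
qed

lemma argmax_arm: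
  assumes "1 \<le> K"
  shows argmax_arm_less: "argmax_arm K v < K"
    and argmax_arm_max: "Max (v ` {..<K}) = v (argmax_arm K v)"
proof -
  let ?P = "\<lambda>i. i < K \<and> (\<forall>j<K. v j \<le> v i)"
  have Max_ge: "v j \<le> Max (v ` {..<K})" if "j < K" for j
    using that by (intro Max_ge) auto
  have "Max (v ` {..<K}) \<in> v ` {..<K}"
    using assms by (intro Max_in) (auto simp: lessThan_empty_iff)
  then obtain i where i: "i < K" "Max (v ` {..<K}) = v i"
    by (elim imageE) simp
  have "?P i"
    using i Max_ge by simp
  then have a: "?P (argmax_arm K v)"
    unfolding argmax_arm_def by (rule LeastI)
  then show "argmax_arm K v < K" by (rule conjunct1)
  show "Max (v ` {..<K}) = v (argmax_arm K v)"
  proof (rule antisym)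
    show "Max (v ` {..<K}) \<le> v (argmax_arm K v)"
      using a i by simp
    show "v (argmax_arm K v) \<le> Max (v ` {..<K})"
      using a by (intro Max_ge) simp
  qed
qed

section \<open>Measurability of histories and of the posterior parameters\<close>

lemma space_histM [simp]: "space histM = UNIV"
  by (auto simp: histM_def space_PiM space_pair_measure)

lemma measurable_hist_component [measurable (raw)]:
  assumes "f \<in> M \<rightarrow>\<^sub>M histM"
  shows "(\<lambda>x. f x t) \<in> M \<rightarrow>\<^sub>M count_space UNIV \<Otimes>\<^sub>M borel"
  using assms unfolding histM_def by measurable

lemma measurable_hist_arm [measurable (raw)]:
  assumes "f \<in> M \<rightarrow>\<^sub>M histM"
  shows "(\<lambda>x. fst (f x t)) \<in> M \<rightarrow>\<^sub>M count_space UNIV"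
  using measurable_compose[OF measurable_hist_component[OF assms] measurable_fst] .

lemma measurable_hist_reward [measurable (raw)]:
  assumes "f \<in> M \<rightarrow>\<^sub>M histM"
  shows "(\<lambda>x. snd (f x t)) \<in> borel_measurable M"
  using measurable_compose[OF measurable_hist_component[OF assms] measurable_snd] .

lemma measurable_hist_upd [measurable (raw)]:
  assumes [measurable]: "f \<in> M \<rightarrow>\<^sub>M histM" "a \<in> M \<rightarrow>\<^sub>M count_space UNIV" "b \<in> borel_measurable M"
  shows "(\<lambda>x. (f x)(t := (a x, b x))) \<in> M \<rightarrow>\<^sub>M histM"
proof -
  have "(\<lambda>x. \<lambda>s\<in>UNIV. if s = t then (a x, b x) else f x s) \<in> M \<rightarrow>\<^sub>M histM"
    unfolding histM_def
  proof (rule measurable_restrict)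
    fix s show "(\<lambda>x. if s = t then (a x, b x) else f x s) \<in> M \<rightarrow>\<^sub>M count_space UNIV \<Otimes>\<^sub>M borel"
      by (cases "s = t") auto
  qed
  then show ?thesis by (simp add: fun_upd_def restrict_def)
qed

text \<open>Trades an index set that depends on the history for a fixed one with an indicator:
  measurability then follows summand by summand, and a new round adds one summand.
  \<open>reward_sum_eq\<close> does the same for the rewards.\<close>

lemma npulls_eq_sum: "real (npulls h t i) = (\<Sum>s<t. if fst (h s) = i then 1 else 0)"
proof -
  have "{s. s < t \<and> fst (h s) = i} = {s \<in> {..<t}. fst (h s) = i}" by auto
  then show ?thesis by (simp add: npulls_def sum.inter_filter[symmetric])
qed

lemma reward_sum_eq:
  "(\<Sum>s\<in>{s. s < t \<and> fst (h s) = i}. snd (h s)) = (\<Sum>s<t::nat. if fst (h s) = i then snd (h s) else (0::real))"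
  by (subst sum.inter_filter[symmetric]) (auto intro!: sum.cong finite_lessThan)

lemma measurable_post_var [measurable (raw)]:
  assumes [measurable]: "f \<in> M \<rightarrow>\<^sub>M histM"
  shows "(\<lambda>x. post_var s0 sig (f x) t i) \<in> borel_measurable M"
  unfolding post_var_def npulls_eq_sum by measurable

lemma measurable_post_mean [measurable (raw)]:
  assumes [measurable]: "f \<in> M \<rightarrow>\<^sub>M histM"
  shows "(\<lambda>x. post_mean m0 s0 sig (f x) t i) \<in> borel_measurable M"
  unfolding post_mean_def reward_sum_eq by measurable

section \<open>Normal conjugacy\<close>

text \<open>Completing the square in \<open>y\<close>: the factors on the right are the marginal
  density of the observation \<open>x\<close> and the posterior density of the mean
  \<open>y\<close>.\<close>

lemma normal_density_conjugate:
  fixes m s \<sigma> x y :: real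
  assumes s: "0 < s" and \<sigma>: "0 < \<sigma>"
  defines "v \<equiv> inverse (inverse (s\<^sup>2) + inverse (\<sigma>\<^sup>2))"
  shows "normal_density m s y * normal_density y \<sigma> x
    = normal_density m (sqrt (s\<^sup>2 + \<sigma>\<^sup>2)) x * normal_density (v * (m / s\<^sup>2 + x / \<sigma>\<^sup>2)) (sqrt v) y"
proof -
  define S T where "S = s\<^sup>2" and "T = \<sigma>\<^sup>2"
  have pos: "0 < S" "0 < T" using s \<sigma> by (simp_all add: S_def T_def)
  have v: "v = S * T / (S + T)"
    using pos by (simp add: v_def S_def[symmetric] T_def[symmetric] field_simps)
  have v_pos: "0 < v" using pos by (simp add: v)
  define w where "w = v * (m / S + x / T)"
  have w: "w = (m * T + x * S) / (S + T)"
    using pos by (simp add: w_def v add_frac_eq)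
  \<comment> \<open>The normalising constants agree because
    \<open>S * T = (S + T) * v\<close>.\<close>
  have const: "sqrt (2 * pi * S) * sqrt (2 * pi * T) = sqrt (2 * pi * (S + T)) * sqrt (2 * pi * v)"
    using pos by (simp add: v real_sqrt_mult[symmetric])
  have "(y - w)\<^sup>2 / (2 * v) = ((S + T) * y - (m * T + x * S))\<^sup>2 / (2 * S * T * (S + T))"
  proof -
    have "y - w = ((S + T) * y - (m * T + x * S)) / (S + T)"
      using pos by (simp add: w field_simps)
    then show ?thesis
      using pos by (simp add: v power_divide) (simp add: power2_eq_square divide_simps)
  qed
  \<comment> \<open>Over the common denominator \<open>2 * S * T * (S + T)\<close> the claim about
    exponents becomes a polynomial identity.\<close>
  also have "(x - m)\<^sup>2 / (2 * (S + T)) + \<dots> = (y - m)\<^sup>2 / (2 * S) + (x - y)\<^sup>2 / (2 * T)"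
  proof -
    have "(x - m)\<^sup>2 * (S * T) + ((S + T) * y - (m * T + x * S))\<^sup>2
        = (y - m)\<^sup>2 * (T * (S + T)) + (x - y)\<^sup>2 * (S * (S + T))"
      by (simp add: power2_eq_square algebra_simps)
    then have "((x - m)\<^sup>2 * (S * T) + ((S + T) * y - (m * T + x * S))\<^sup>2) / (2 * S * T * (S + T))
        = ((y - m)\<^sup>2 * (T * (S + T)) + (x - y)\<^sup>2 * (S * (S + T))) / (2 * S * T * (S + T))"
      by simp
    moreover have "(x - m)\<^sup>2 * (S * T) / (2 * S * T * (S + T)) = (x - m)\<^sup>2 / (2 * (S + T))"
      "(y - m)\<^sup>2 * (T * (S + T)) / (2 * S * T * (S + T)) = (y - m)\<^sup>2 / (2 * S)"
      "(x - y)\<^sup>2 * (S * (S + T)) / (2 * S * T * (S + T)) = (x - y)\<^sup>2 / (2 * T)"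
      using pos by (simp_all add: divide_simps)
    ultimately show ?thesis
      by (simp only: add_divide_distrib)
  qed
  finally have expo: "exp (- (y - m)\<^sup>2 / (2 * S)) * exp (- (x - y)\<^sup>2 / (2 * T))
      = exp (- (x - m)\<^sup>2 / (2 * (S + T))) * exp (- (y - w)\<^sup>2 / (2 * v))"
    by (simp add: exp_add[symmetric])
  have "normal_density m s y * normal_density y \<sigma> x
      = (exp (- (y - m)\<^sup>2 / (2 * S)) * exp (- (x - y)\<^sup>2 / (2 * T)))
        / (sqrt (2 * pi * S) * sqrt (2 * pi * T))"
    by (simp add: normal_density_def S_def T_def)
  also have "\<dots> = (exp (- (x - m)\<^sup>2 / (2 * (S + T))) * exp (- (y - w)\<^sup>2 / (2 * v)))
        / (sqrt (2 * pi * (S + T)) * sqrt (2 * pi * v))"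
    by (simp only: expo const)
  also have "\<dots> = normal_density m (sqrt (S + T)) x * normal_density w (sqrt v) y"
    using pos v_pos by (simp add: normal_density_def)
  finally show ?thesis
    by (simp add: w_def S_def T_def)
qed

text \<open>The integrand may couple \<open>y\<close> and \<open>x\<close>, since the test functions
  of the disintegration see both the means and the recorded reward.\<close>

lemma nn_integral_gauss_conjugate:
  fixes m s \<sigma> :: real
  assumes s: "0 < s" and \<sigma>: "0 < \<sigma>"
    and [measurable]: "case_prod G \<in> borel_measurable (borel \<Otimes>\<^sub>M borel)"
  defines "v \<equiv> inverse (inverse (s\<^sup>2) + inverse (\<sigma>\<^sup>2))"
  shows "(\<integral>\<^sup>+y. (\<integral>\<^sup>+x. G y x \<partial>gauss y \<sigma>) \<partial>gauss m s)
    = (\<integral>\<^sup>+x. (\<integral>\<^sup>+y. G y x \<partial>gauss (v * (m / s\<^sup>2 + x / \<sigma>\<^sup>2)) (sqrt v)) \<partial>gauss m (sqrt (s\<^sup>2 + \<sigma>\<^sup>2)))"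
proof -
  let ?w = "\<lambda>x. v * (m / s\<^sup>2 + x / \<sigma>\<^sup>2)" and ?\<tau> = "sqrt (s\<^sup>2 + \<sigma>\<^sup>2)"
  have "(\<integral>\<^sup>+y. (\<integral>\<^sup>+x. G y x \<partial>gauss y \<sigma>) \<partial>gauss m s)
      = (\<integral>\<^sup>+y. ennreal (normal_density m s y)
          * (\<integral>\<^sup>+x. ennreal (normal_density y \<sigma> x) * G y x \<partial>lborel) \<partial>lborel)"
    by (simp add: nn_integral_gauss)
  also have "\<dots> = (\<integral>\<^sup>+y. (\<integral>\<^sup>+x. ennreal (normal_density m s y)
          * (ennreal (normal_density y \<sigma> x) * G y x) \<partial>lborel) \<partial>lborel)"
    by (subst nn_integral_cmult) simp_all
  also have "\<dots> = (\<integral>\<^sup>+x. (\<integral>\<^sup>+y. ennreal (normal_density m s y)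
          * (ennreal (normal_density y \<sigma> x) * G y x) \<partial>lborel) \<partial>lborel)"
    by (rule lborel_pair.Fubini') simp
  also have "\<dots> = (\<integral>\<^sup>+x. (\<integral>\<^sup>+y. ennreal (normal_density m ?\<tau> x)
          * (ennreal (normal_density (?w x) (sqrt v) y) * G y x) \<partial>lborel) \<partial>lborel)"
    using normal_density_conjugate[OF s \<sigma>, folded v_def]
    by (simp add: mult.assoc[symmetric] ennreal_mult'[symmetric])
  also have "\<dots> = (\<integral>\<^sup>+x. ennreal (normal_density m ?\<tau> x)
          * (\<integral>\<^sup>+y. ennreal (normal_density (?w x) (sqrt v) y) * G y x \<partial>lborel) \<partial>lborel)"
    by (subst nn_integral_cmult) simp_all
  also have "\<dots> = (\<integral>\<^sup>+x. (\<integral>\<^sup>+y. G y x \<partial>gauss (?w x) (sqrt v)) \<partial>gauss m ?\<tau>)"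
    by (simp add: nn_integral_gauss)
  finally show ?thesis .
qed

text \<open>A reward of arm \<open>a\<close> carries information on coordinate \<open>a\<close>
  only. Splitting that coordinate off reduces the claim to one dimension; the other coordinates,
  being independent, keep their law.\<close>

lemma PiM_gauss_conjugate:
  fixes m s :: "'i \<Rightarrow> real" and \<sigma> :: real
  assumes I: "finite I" and a: "a \<in> I" and s: "0 < s a" and \<sigma>: "0 < \<sigma>"
    and F [measurable]: "case_prod F \<in> borel_measurable (PiM I (\<lambda>_. borel) \<Otimes>\<^sub>M borel)"
  defines "v \<equiv> inverse (inverse ((s a)\<^sup>2) + inverse (\<sigma>\<^sup>2))"
  shows "(\<integral>\<^sup>+\<mu>. (\<integral>\<^sup>+x. F \<mu> x \<partial>gauss (\<mu> a) \<sigma>) \<partial>PiM I (\<lambda>i. gauss (m i) (s i)))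
    = (\<integral>\<^sup>+x. (\<integral>\<^sup>+\<mu>. F \<mu> x \<partial>PiM I (\<lambda>i. gauss ((m(a := v * (m a / (s a)\<^sup>2 + x / \<sigma>\<^sup>2))) i)
          ((s(a := sqrt v)) i))) \<partial>gauss (m a) (sqrt ((s a)\<^sup>2 + \<sigma>\<^sup>2)))"
proof -
  define J where "J = I - {a}"
  have J: "finite J" "a \<notin> J" and I_eq: "I = insert a J"
    using I a by (auto simp: J_def)
  let ?w = "\<lambda>x. v * (m a / (s a)\<^sup>2 + x / \<sigma>\<^sup>2)" and ?\<tau> = "sqrt ((s a)\<^sup>2 + \<sigma>\<^sup>2)"
  let ?P = "PiM J (\<lambda>i. gauss (m i) (s i))"
  note F' [measurable] = F[unfolded I_eq]
  have upd [measurable]: "(\<lambda>p. (fst p)(a := snd p)) \<in> PiM J (\<lambda>_. borel) \<Otimes>\<^sub>M borel \<rightarrow>\<^sub>M PiM (insert a J) (\<lambda>_. borel)"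
    by measurable
  have comp [measurable]: "(\<lambda>\<mu>. \<mu> a) \<in> borel_measurable (PiM (insert a J) (\<lambda>_. borel))"
    by simp
  have int [measurable]: "(\<lambda>\<mu>. \<integral>\<^sup>+x. F \<mu> x \<partial>gauss (\<mu> a) \<sigma>) \<in> borel_measurable (PiM (insert a J) (\<lambda>_. borel))"
    by (rule nn_integral_measurable_subprob_algebra2[where N=borel]) simp_all
  interpret P: sigma_finite_measure ?P
    using J by (intro product_sigma_finite.sigma_finite product_sigma_finite_gauss)
  have [measurable]: "(\<lambda>p. F ((fst p)(a := fst (snd p))) (snd (snd p)))
      \<in> borel_measurable (PiM J (\<lambda>_. borel) \<Otimes>\<^sub>M (borel \<Otimes>\<^sub>M borel))"
    by measurable
  have "(\<integral>\<^sup>+\<mu>. (\<integral>\<^sup>+x. F \<mu> x \<partial>gauss (\<mu> a) \<sigma>) \<partial>PiM I (\<lambda>i. gauss (m i) (s i)))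
      = (\<integral>\<^sup>+\<mu>. (\<integral>\<^sup>+y. (\<integral>\<^sup>+x. F (\<mu>(a := y)) x \<partial>gauss y \<sigma>) \<partial>gauss (m a) (s a)) \<partial>?P)"
    unfolding I_eq using J
    by (subst product_sigma_finite.product_nn_integral_insert[OF product_sigma_finite_gauss])
       (simp_all cong: measurable_cong_sets)
  also have "\<dots> = (\<integral>\<^sup>+\<mu>. (\<integral>\<^sup>+x. (\<integral>\<^sup>+y. F (\<mu>(a := y)) x \<partial>gauss (?w x) (sqrt v)) \<partial>gauss (m a) ?\<tau>) \<partial>?P)"
    unfolding v_def
    by (intro nn_integral_cong nn_integral_gauss_conjugate s \<sigma>) simp
  also have "\<dots> = (\<integral>\<^sup>+x. (\<integral>\<^sup>+\<mu>. (\<integral>\<^sup>+y. F (\<mu>(a := y)) x \<partial>gauss (?w x) (sqrt v)) \<partial>?P) \<partial>gauss (m a) ?\<tau>)"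
  proof (rule pair_sigma_finite.Fubini')
    show "pair_sigma_finite (gauss (m a) ?\<tau>) ?P"
      by (simp add: pair_sigma_finite_def P.sigma_finite_measure_axioms sigma_finite_gauss)
    have "(\<lambda>p. \<integral>\<^sup>+y. F ((snd p)(a := y)) (fst p) \<partial>gauss (?w (fst p)) (sqrt v))
      \<in> borel_measurable (borel \<Otimes>\<^sub>M PiM J (\<lambda>_. borel))"
      by (rule nn_integral_measurable_subprob_algebra2[where N=borel]) simp_all
    then show "(\<lambda>(x, \<mu>). \<integral>\<^sup>+y. F (\<mu>(a := y)) x \<partial>gauss (?w x) (sqrt v))
        \<in> borel_measurable (gauss (m a) ?\<tau> \<Otimes>\<^sub>M ?P)"
      by (simp add: split_beta' cong: measurable_cong_sets)
  qed
  also have "\<dots> = (\<integral>\<^sup>+x. (\<integral>\<^sup>+\<mu>. F \<mu> x \<partial>PiM I (\<lambda>i. gauss ((m(a := ?w x)) i) ((s(a := sqrt v)) i))) \<partial>gauss (m a) ?\<tau>)"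
  proof (rule nn_integral_cong)
    fix x
    have P_eq: "?P = PiM J (\<lambda>i. gauss ((m(a := ?w x)) i) ((s(a := sqrt v)) i))"
      using J by (intro PiM_cong) auto
    have [measurable]: "(\<lambda>\<mu>. F \<mu> x) \<in> borel_measurable (PiM (insert a J) (\<lambda>_. borel))"
      by simp
    show "(\<integral>\<^sup>+\<mu>. (\<integral>\<^sup>+y. F (\<mu>(a := y)) x \<partial>gauss (?w x) (sqrt v)) \<partial>?P)
      = (\<integral>\<^sup>+\<mu>. F \<mu> x \<partial>PiM I (\<lambda>i. gauss ((m(a := ?w x)) i) ((s(a := sqrt v)) i)))"
      unfolding P_eq I_eq using J
      by (subst product_sigma_finite.product_nn_integral_insert[OF product_sigma_finite_gauss])
         (simp_all cong: measurable_cong_sets)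
  qed
  finally show ?thesis .
qed

section \<open>The posterior law of the means\<close>

text \<open>The coordinate is itself random; countability of the index type allows each fixed
  coordinate to be treated separately.\<close>

lemma measurable_PiM_eval:
  fixes f :: "'a \<Rightarrow> 'i::countable \<Rightarrow> real"
  assumes f: "f \<in> M \<rightarrow>\<^sub>M PiM I (\<lambda>_. borel)" and g: "g \<in> M \<rightarrow>\<^sub>M count_space UNIV"
  shows "(\<lambda>x. f x (g x)) \<in> borel_measurable M"
  by (rule measurable_compose_countable[OF measurable_compose[OF f measurable_PiM_component_total] g])

section \<open>One-round recursion of the posterior parameters\<close>

lemma npulls_upd:
  "real (npulls (h(t := (a, x))) (Suc t) i) = real (npulls h t i) + (if i = a then 1 else 0)"
  by (simp add: npulls_eq_sum)

lemma reward_sum_upd: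
  "(\<Sum>s<Suc t. if fst ((h(t := (a, x))) s) = i then snd ((h(t := (a, x))) s) else 0)
    = (\<Sum>s<t. if fst (h s) = i then snd (h s) else (0::real)) + (if i = a then x else 0)"
proof -
  have "(\<Sum>s<t. if fst ((h(t := (a, x))) s) = i then snd ((h(t := (a, x))) s) else 0)
    = (\<Sum>s<t. if fst (h s) = i then snd (h s) else (0::real))"
    by (intro sum.cong) auto
  then show ?thesis by (auto simp: sum.lessThan_Suc)
qed

text \<open>Precisions add up over observations. In this form the update is the \<open>v\<close> of
  \<open>normal_density_conjugate\<close>, with the current posterior variance in place of the prior
  one.\<close>

lemma post_var_upd_same:
  "post_var s0 sig (h(t := (a, x))) (Suc t) a
    = inverse (inverse (post_var s0 sig h t a) + inverse ((sig a)\<^sup>2))"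
  unfolding post_var_def by (simp only: npulls_upd) (simp add: algebra_simps)

lemma post_var_upd_other:
  "i \<noteq> a \<Longrightarrow> post_var s0 sig (h(t := (a, x))) (Suc t) i = post_var s0 sig h t i"
  unfolding post_var_def by (simp only: npulls_upd) simp

text \<open>Dividing the mean by the variance recovers the precision-weighted sum, to which a reward
  contributes one additive term; a nonzero variance is what makes the division undo the factor in
  \<open>post_mean\<close>.\<close>

lemma post_mean_upd_same:
  assumes "post_var s0 sig h t a \<noteq> 0"
  shows "post_mean m0 s0 sig (h(t := (a, x))) (Suc t) a
    = post_var s0 sig (h(t := (a, x))) (Suc t) a
      * (post_mean m0 s0 sig h t a / post_var s0 sig h t a + x / (sig a)\<^sup>2)"
proof -
  have "post_mean m0 s0 sig h t a / post_var s0 sig h t a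
      = m0 a / (s0 a)\<^sup>2 + inverse ((sig a)\<^sup>2) * (\<Sum>s<t. if fst (h s) = a then snd (h s) else 0)"
    using assms by (simp add: post_mean_def reward_sum_eq)
  then show ?thesis
    unfolding post_mean_def[of _ _ _ "h(t := (a, x))"] reward_sum_eq reward_sum_upd
    by (simp add: distrib_left divide_inverse mult_ac)
qed

lemma post_mean_upd_other:
  "i \<noteq> a \<Longrightarrow> post_mean m0 s0 sig (h(t := (a, x))) (Suc t) i = post_mean m0 s0 sig h t i"
  unfolding post_mean_def reward_sum_eq reward_sum_upd by (simp add: post_var_upd_other)

lemma post_var_pos:
  assumes "0 < s0 i"
  shows "0 < post_var s0 sig h t i"
  unfolding post_var_def using assms by (intro positive_imp_inverse_positive add_pos_nonneg) auto

lemma post_var_le_prior: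
  assumes "0 < s0 i"
  shows "post_var s0 sig h t i \<le> (s0 i)\<^sup>2"
proof -
  have "post_var s0 sig h t i \<le> inverse (inverse ((s0 i)\<^sup>2))"
    unfolding post_var_def using assms by (intro le_imp_inverse_le) auto
  then show ?thesis by simp
qed

section \<open>The sampling loop as a composition of kernels, and Bayes' theorem along it\<close>

locale gaussian_thompson_sampling =
  fixes K :: nat and m0 s0 sig :: "nat \<Rightarrow> real"
  assumes K: "1 \<le> K"
    and s0_pos: "\<And>i. i < K \<Longrightarrow> 0 < s0 i"
    and sig_pos: "\<And>i. i < K \<Longrightarrow> 0 < sig i"
begin

abbreviation meansM :: "(nat \<Rightarrow> real) measure" where
  "meansM \<equiv> PiM {..<K} (\<lambda>_. borel)"

abbreviation pmean where "pmean \<equiv> post_mean m0 s0 sig"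
abbreviation pvar where "pvar \<equiv> post_var s0 sig"

abbreviation posterior :: "nat \<Rightarrow> (nat \<Rightarrow> nat \<times> real) \<Rightarrow> (nat \<Rightarrow> real) measure" where
  "posterior t h \<equiv> PiM {..<K} (\<lambda>i. gauss (pmean h t i) (sqrt (pvar h t i)))"

abbreviation hist :: "(nat \<Rightarrow> real) \<Rightarrow> nat \<Rightarrow> (nat \<Rightarrow> nat \<times> real) measure" where
  "hist \<equiv> ts_hist K m0 s0 sig"

abbreviation arm where "arm \<equiv> argmax_arm K"

lemma arm_less: "arm v < K"
  using K by (rule argmax_arm_less)

lemma pvar_pos: "i < K \<Longrightarrow> 0 < pvar h t i"
  by (intro post_var_pos s0_pos)

lemma posterior_0: "posterior 0 h = prior K m0 s0"
  unfolding prior_def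
proof (rule PiM_cong[OF refl])
  fix i assume "i \<in> {..<K}"
  then have "0 < s0 i" by (simp add: s0_pos)
  then show "gauss (pmean h 0 i) (sqrt (pvar h 0 i)) = gauss (m0 i) (s0 i)"
    by (simp add: post_mean_def post_var_def npulls_def real_sqrt_unique)
qed

lemma prob_space_posterior: "prob_space (posterior t h)"
  by (intro prob_space_PiM prob_space_gauss) (simp add: pvar_pos)

lemma measurable_posterior [measurable]:
  "posterior t \<in> histM \<rightarrow>\<^sub>M subprob_algebra meansM"
  by (intro measurable_PiM_gauss) simp_all

lemma measurable_post_moments_arm [measurable]:
  assumes [measurable]: "f \<in> M \<rightarrow>\<^sub>M histM" "g \<in> M \<rightarrow>\<^sub>M count_space UNIV"
  shows "(\<lambda>x. pmean (f x) t (g x)) \<in> borel_measurable M"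
    and "(\<lambda>x. pvar (f x) t (g x)) \<in> borel_measurable M"
    and "(\<lambda>x. sig (g x)) \<in> borel_measurable M"
  by (rule measurable_compose_countable[OF _ assms(2)], simp)+

text \<open>Mean and standard deviation of the reward stay abstract, because the same pull occurs
  with the true mean in \<open>ts_step\<close> and with predictive parameters in
  \<open>predictive_step\<close>.\<close>

lemma measurable_play:
  assumes [measurable]: "f \<in> M \<rightarrow>\<^sub>M histM" "a \<in> M \<rightarrow>\<^sub>M count_space UNIV"
    "m \<in> borel_measurable M" "s \<in> borel_measurable M"
  shows "(\<lambda>p. gauss (m p) (s p) \<bind> (\<lambda>x. return histM ((f p)(t := (a p, x))))) \<in> M \<rightarrow>\<^sub>M subprob_algebra histM"
  by (rule measurable_bind[where N=borel])
     (auto intro!: measurable_compose[OF _ return_measurable] measurable_gauss measurable_hist_upd)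

lemma nn_integral_play:
  assumes [measurable]: "f \<in> borel_measurable histM"
  shows "(\<integral>\<^sup>+h'. f h' \<partial>(gauss m s \<bind> (\<lambda>x. return histM (h(t := (a, x))))))
    = (\<integral>\<^sup>+x. f (h(t := (a, x))) \<partial>gauss m s)"
proof -
  have "(\<lambda>x. return histM (h(t := (a, x)))) \<in> gauss m s \<rightarrow>\<^sub>M subprob_algebra histM"
    by (intro measurable_compose[OF _ return_measurable] measurable_hist_upd) auto
  then show ?thesis
    by (subst nn_integral_bind[where B=histM]) (simp_all add: nn_integral_return)
qed

lemma measurable_ts_step:
  "(\<lambda>(\<mu>, h). ts_step K m0 s0 sig \<mu> t h) \<in> meansM \<Otimes>\<^sub>M histM \<rightarrow>\<^sub>M subprob_algebra histM"
proof -
  let ?M = "(meansM \<Otimes>\<^sub>M histM) \<Otimes>\<^sub>M meansM"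
  have arm: "(\<lambda>p. arm (snd p)) \<in> ?M \<rightarrow>\<^sub>M count_space UNIV"
    by measurable
  have mean: "(\<lambda>p. fst (fst p) (arm (snd p))) \<in> borel_measurable ?M"
    by (rule measurable_PiM_eval[OF _ arm]) (rule measurable_compose[OF measurable_fst measurable_fst])
  have sd: "(\<lambda>p. sig (arm (snd p))) \<in> borel_measurable ?M"
    by (rule measurable_compose[OF arm]) simp
  have "(\<lambda>p. gauss (fst (fst p) (arm (snd p))) (sig (arm (snd p)))
        \<bind> (\<lambda>x. return histM ((snd (fst p))(t := (arm (snd p), x))))) \<in> ?M \<rightarrow>\<^sub>M subprob_algebra histM"
    by (rule measurable_play[OF _ arm mean sd]) measurable
  then show ?thesis
    unfolding ts_step_def Let_def split_beta'
    by (intro measurable_bind[where N=meansM] measurable_compose[OF measurable_snd measurable_posterior])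
qed

lemma measurable_ts_step_hist:
  assumes "\<mu> \<in> space meansM"
  shows "ts_step K m0 s0 sig \<mu> t \<in> histM \<rightarrow>\<^sub>M subprob_algebra histM"
  using measurable_compose[OF measurable_Pair1'[OF assms] measurable_ts_step[of t]] by simp

lemma nn_integral_ts_step:
  assumes f [measurable]: "f \<in> borel_measurable histM" and \<mu>: "\<mu> \<in> space meansM"
  shows "(\<integral>\<^sup>+h'. f h' \<partial>ts_step K m0 s0 sig \<mu> t h)
    = (\<integral>\<^sup>+v. (\<integral>\<^sup>+x. f (h(t := (arm v, x))) \<partial>gauss (\<mu> (arm v)) (sig (arm v))) \<partial>posterior t h)"
proof -
  have [measurable]: "(\<lambda>v. \<mu> (arm v)) \<in> borel_measurable meansM" "(\<lambda>v. sig (arm v)) \<in> borel_measurable meansM"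
    by (rule measurable_compose[OF measurable_argmax_arm], simp)+
  have "(\<lambda>v. gauss (\<mu> (arm v)) (sig (arm v)) \<bind> (\<lambda>x. return histM (h(t := (arm v, x)))))
      \<in> posterior t h \<rightarrow>\<^sub>M subprob_algebra histM"
    by (subst measurable_cong_sets[OF sets_PiM_gauss refl])
       (intro measurable_play; measurable)
  then show ?thesis
    unfolding ts_step_def Let_def
    by (subst nn_integral_bind[OF f]) (simp_all add: nn_integral_play)
qed

lemma measurable_hist: "(\<lambda>\<mu>. hist \<mu> t) \<in> meansM \<rightarrow>\<^sub>M subprob_algebra histM"
proof (induction t)
  case (Suc t)
  show ?case
    unfolding ts_hist.simps
    by (rule measurable_bind[OF Suc]) (use measurable_ts_step[of t] in \<open>simp add: split_beta'\<close>)
qed (simp add: measurable_const space_subprob_algebra subprob_space_return)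

lemma sets_hist [measurable_cong]: "\<mu> \<in> space meansM \<Longrightarrow> sets (hist \<mu> t) = sets histM"
  by (rule sets_kernel[OF measurable_hist])

lemma nn_integral_hist_Suc:
  assumes [measurable]: "f \<in> borel_measurable histM" and \<mu>: "\<mu> \<in> space meansM"
  shows "(\<integral>\<^sup>+h. f h \<partial>hist \<mu> (Suc t)) = (\<integral>\<^sup>+h. (\<integral>\<^sup>+v. (\<integral>\<^sup>+x. f (h(t := (arm v, x)))
    \<partial>gauss (\<mu> (arm v)) (sig (arm v))) \<partial>posterior t h) \<partial>hist \<mu> t)"
  unfolding ts_hist.simps
  by (subst nn_integral_bind[where B=histM])
     (simp_all add: nn_integral_ts_step \<mu> measurable_ts_step_hist
        measurable_cong_sets[OF sets_hist[OF \<mu>] refl])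

text \<open>Conjugacy with the posterior of round \<open>t\<close> in the role of the prior. The
  reward turns into a predictive draw, whose variance is posterior uncertainty plus noise.\<close>

lemma posterior_update:
  assumes a: "a < K" and [measurable]: "case_prod f \<in> borel_measurable (meansM \<Otimes>\<^sub>M histM)"
  shows "(\<integral>\<^sup>+\<mu>. (\<integral>\<^sup>+x. f \<mu> (h(t := (a, x))) \<partial>gauss (\<mu> a) (sig a)) \<partial>posterior t h)
    = (\<integral>\<^sup>+x. (\<integral>\<^sup>+\<mu>. f \<mu> (h(t := (a, x))) \<partial>posterior (Suc t) (h(t := (a, x))))
        \<partial>gauss (pmean h t a) (sqrt (pvar h t a + (sig a)\<^sup>2)))"
proof -
  let ?v = "inverse (inverse (pvar h t a) + inverse ((sig a)\<^sup>2))"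
  have [measurable]: "(\<lambda>p. h(t := (a, snd p))) \<in> meansM \<Otimes>\<^sub>M borel \<rightarrow>\<^sub>M histM"
    by (intro measurable_hist_upd) auto
  have meas: "(\<lambda>(\<mu>, x). f \<mu> (h(t := (a, x)))) \<in> borel_measurable (meansM \<Otimes>\<^sub>M borel)"
    unfolding split_beta' by measurable
  have pv: "(sqrt (pvar h t a))\<^sup>2 = pvar h t a"
    using pvar_pos[OF a, of h t] by simp
  \<comment> \<open>The closed-form parameters of the extended history are the sequentially updated
    ones, at the pulled arm and at all others.\<close>
  have eq: "(\<lambda>i. gauss (((pmean h t)(a := ?v
          * (pmean h t a / pvar h t a + x / (sig a)\<^sup>2))) i)
        (((\<lambda>i. sqrt (pvar h t i))(a := sqrt ?v)) i))
      = (\<lambda>i. gauss (pmean (h(t := (a, x))) (Suc t) i) (sqrt (pvar (h(t := (a, x))) (Suc t) i)))" for x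
    using pvar_pos[OF a, of h t]
    by (intro ext) (simp add: post_mean_upd_same post_var_upd_same post_mean_upd_other post_var_upd_other)
  show ?thesis
    using PiM_gauss_conjugate[where I="{..<K}" and a=a and m="pmean h t" and s="\<lambda>i. sqrt (pvar h t i)" and \<sigma>="sig a",
        OF _ _ _ _ meas] a pvar_pos[OF a, of h t] sig_pos[OF a]
    by (simp only: pv eq finite_lessThan lessThan_iff real_sqrt_gt_0_iff)
qed

text \<open>The step of the history with the means integrated out; nothing in it refers to
  \<open>\<mu>\<close>.\<close>

definition predictive_step :: "nat \<Rightarrow> (nat \<Rightarrow> nat \<times> real) \<Rightarrow> (nat \<Rightarrow> nat \<times> real) measure" where
  "predictive_step t h = posterior t h \<bind> (\<lambda>v.
     gauss (pmean h t (arm v)) (sqrt (pvar h t (arm v) + (sig (arm v))\<^sup>2))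
       \<bind> (\<lambda>x. return histM (h(t := (arm v, x)))))"

lemma measurable_predictive_step:
  "predictive_step t \<in> histM \<rightarrow>\<^sub>M subprob_algebra histM"
proof -
  let ?M = "histM \<Otimes>\<^sub>M meansM"
  have arm: "(\<lambda>p. arm (snd p)) \<in> ?M \<rightarrow>\<^sub>M count_space UNIV"
    by measurable
  note [measurable] = measurable_post_moments_arm[OF measurable_fst arm]
  have "(\<lambda>p. gauss (pmean (fst p) t (arm (snd p))) (sqrt (pvar (fst p) t (arm (snd p)) + (sig (arm (snd p)))\<^sup>2))
        \<bind> (\<lambda>x. return histM ((fst p)(t := (arm (snd p), x))))) \<in> ?M \<rightarrow>\<^sub>M subprob_algebra histM"
    by (rule measurable_play[OF _ arm]) measurable
  then show ?thesis
    unfolding predictive_step_def[abs_def]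
    by (intro measurable_bind[where N=meansM] measurable_posterior)
qed

lemma nn_integral_predictive_step:
  assumes f [measurable]: "f \<in> borel_measurable histM"
  shows "(\<integral>\<^sup>+h'. f h' \<partial>predictive_step t h) = (\<integral>\<^sup>+v. (\<integral>\<^sup>+x. f (h(t := (arm v, x)))
    \<partial>gauss (pmean h t (arm v)) (sqrt (pvar h t (arm v) + (sig (arm v))\<^sup>2))) \<partial>posterior t h)"
proof -
  have h: "(\<lambda>_. h) \<in> meansM \<rightarrow>\<^sub>M histM" by simp
  note [measurable] = measurable_post_moments_arm[OF h measurable_argmax_arm]
  have "(\<lambda>v. gauss (pmean h t (arm v)) (sqrt (pvar h t (arm v) + (sig (arm v))\<^sup>2))
       \<bind> (\<lambda>x. return histM (h(t := (arm v, x))))) \<in> posterior t h \<rightarrow>\<^sub>M subprob_algebra histM"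
    by (subst measurable_cong_sets[OF sets_PiM_gauss refl])
       (intro measurable_play; measurable)
  then show ?thesis
    unfolding predictive_step_def
    by (subst nn_integral_bind[OF f]) (simp_all add: nn_integral_play)
qed

text \<open>Both \<open>\<mu>\<close> and \<open>v\<close> are drawn from the posterior of the same
  \<open>h\<close>, independently, so Fubini allows \<open>v\<close> to be fixed first. This fixes
  the pulled arm, and \<open>posterior_update\<close> applies to it.\<close>

lemma posterior_ts_step:
  assumes f [measurable]: "case_prod f \<in> borel_measurable (meansM \<Otimes>\<^sub>M histM)"
  shows "(\<integral>\<^sup>+\<mu>. (\<integral>\<^sup>+h'. f \<mu> h' \<partial>ts_step K m0 s0 sig \<mu> t h) \<partial>posterior t h)
    = (\<integral>\<^sup>+h'. (\<integral>\<^sup>+\<mu>. f \<mu> h' \<partial>posterior (Suc t) h') \<partial>predictive_step t h)"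
proof -
  interpret P: prob_space "posterior t h" by (rule prob_space_posterior)
  let ?G = "\<lambda>\<mu> v. \<integral>\<^sup>+x. f \<mu> (h(t := (arm v, x))) \<partial>gauss (\<mu> (arm v)) (sig (arm v))"
  have "(\<integral>\<^sup>+\<mu>. (\<integral>\<^sup>+h'. f \<mu> h' \<partial>ts_step K m0 s0 sig \<mu> t h) \<partial>posterior t h)
      = (\<integral>\<^sup>+\<mu>. (\<integral>\<^sup>+v. ?G \<mu> v \<partial>posterior t h) \<partial>posterior t h)"
    by (intro nn_integral_cong nn_integral_ts_step) auto
  also have "\<dots> = (\<integral>\<^sup>+v. (\<integral>\<^sup>+\<mu>. ?G \<mu> v \<partial>posterior t h) \<partial>posterior t h)"
  proof (rule pair_sigma_finite.Fubini')
    show "pair_sigma_finite (posterior t h) (posterior t h)"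
      by (simp add: pair_sigma_finite_def P.sigma_finite_measure_axioms)
    let ?M = "meansM \<Otimes>\<^sub>M meansM"
    have arm: "(\<lambda>p. arm (fst p)) \<in> ?M \<rightarrow>\<^sub>M count_space UNIV"
      by measurable
    have [measurable]: "(\<lambda>p. snd p (arm (fst p))) \<in> borel_measurable ?M"
      by (rule measurable_PiM_eval[OF measurable_snd arm])
    have [measurable]: "(\<lambda>p. sig (arm (fst p))) \<in> borel_measurable ?M"
      by (rule measurable_compose[OF arm]) simp
    have [measurable]: "(\<lambda>q. h(t := (arm (fst (fst q)), snd q))) \<in> ?M \<Otimes>\<^sub>M borel \<rightarrow>\<^sub>M histM"
      by (intro measurable_hist_upd measurable_compose[OF measurable_fst arm]) auto
    have "(\<lambda>p. ?G (snd p) (fst p)) \<in> borel_measurable ?M"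
      by (rule nn_integral_measurable_subprob_algebra2[where N=borel])
         (auto simp: split_beta')
    then show "(\<lambda>(v, \<mu>). ?G \<mu> v) \<in> borel_measurable (posterior t h \<Otimes>\<^sub>M posterior t h)"
      by (simp add: split_beta' cong: measurable_cong_sets)
  qed
  also have "\<dots> = (\<integral>\<^sup>+v. (\<integral>\<^sup>+x. (\<integral>\<^sup>+\<mu>. f \<mu> (h(t := (arm v, x))) \<partial>posterior (Suc t) (h(t := (arm v, x))))
      \<partial>gauss (pmean h t (arm v)) (sqrt (pvar h t (arm v) + (sig (arm v))\<^sup>2))) \<partial>posterior t h)"
    by (intro nn_integral_cong posterior_update arm_less f)
  also have "\<dots> = (\<integral>\<^sup>+h'. (\<integral>\<^sup>+\<mu>. f \<mu> h' \<partial>posterior (Suc t) h') \<partial>predictive_step t h)"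
  proof (rule nn_integral_predictive_step[symmetric])
    show "(\<lambda>h'. \<integral>\<^sup>+\<mu>. f \<mu> h' \<partial>posterior (Suc t) h') \<in> borel_measurable histM"
      by (rule nn_integral_measurable_subprob_algebra2[where N=meansM]) simp_all
  qed
  finally show ?thesis .
qed

lemma measurable_nn_integral_posterior:
  assumes [measurable]: "case_prod f \<in> borel_measurable (meansM \<Otimes>\<^sub>M histM)"
  shows "(\<lambda>h. \<integral>\<^sup>+\<mu>. f \<mu> h \<partial>posterior t h) \<in> borel_measurable histM"
  by (rule nn_integral_measurable_subprob_algebra2[where N=meansM]) simp_all

lemma measurable_nn_integral_ts_step:
  assumes f [measurable]: "case_prod f \<in> borel_measurable (meansM \<Otimes>\<^sub>M histM)"
  shows "(\<lambda>(\<mu>, h). \<integral>\<^sup>+h'. f \<mu> h' \<partial>ts_step K m0 s0 sig \<mu> t h) \<in> borel_measurable (meansM \<Otimes>\<^sub>M histM)"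
  unfolding split_beta'
  by (rule nn_integral_measurable_subprob_algebra2[where N=histM])
     (use measurable_ts_step[of t] in \<open>simp_all add: split_beta'\<close>)

lemma sets_prior [simp, measurable_cong]: "sets (prior K m0 s0) = sets meansM"
  and space_prior [simp]: "space (prior K m0 s0) = space meansM"
  by (simp_all add: prior_def)

text \<open>Here \<open>Q\<close> is the marginal law of the history, so this is Bayes' theorem: given the
  history, the mean vector is distributed according to \<open>posterior\<close>.\<close>

lemma posterior_disintegration:
  obtains Q where "sets Q = sets histM"
    and "\<And>f. case_prod f \<in> borel_measurable (meansM \<Otimes>\<^sub>M histM) \<Longrightarrow>
      (\<integral>\<^sup>+\<mu>. (\<integral>\<^sup>+h. f \<mu> h \<partial>hist \<mu> t) \<partial>prior K m0 s0)
        = (\<integral>\<^sup>+h. (\<integral>\<^sup>+\<mu>. f \<mu> h \<partial>posterior t h) \<partial>Q)"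
proof -
  have "\<exists>Q. sets Q = sets histM \<and> (\<forall>f. case_prod f \<in> borel_measurable (meansM \<Otimes>\<^sub>M histM) \<longrightarrow>
      (\<integral>\<^sup>+\<mu>. (\<integral>\<^sup>+h. f \<mu> h \<partial>hist \<mu> t) \<partial>prior K m0 s0)
        = (\<integral>\<^sup>+h. (\<integral>\<^sup>+\<mu>. f \<mu> h \<partial>posterior t h) \<partial>Q))"
  proof (induction t)
    case 0
    \<comment> \<open>Before the first round the law of the history is the point mass at the initial
      history.\<close>
    show ?case
    proof (intro exI[of _ "return histM (\<lambda>_. (0, 0))"] conjI allI impI)
      fix f :: "(nat \<Rightarrow> real) \<Rightarrow> (nat \<Rightarrow> nat \<times> real) \<Rightarrow> ennreal"
      assume f [measurable]: "case_prod f \<in> borel_measurable (meansM \<Otimes>\<^sub>M histM)"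
      have "(\<integral>\<^sup>+\<mu>. (\<integral>\<^sup>+h. f \<mu> h \<partial>hist \<mu> 0) \<partial>prior K m0 s0) = (\<integral>\<^sup>+\<mu>. f \<mu> (\<lambda>_. (0, 0)) \<partial>prior K m0 s0)"
        unfolding ts_hist.simps by (intro nn_integral_cong nn_integral_return) simp_all
      also have "\<dots> = (\<integral>\<^sup>+h. (\<integral>\<^sup>+\<mu>. f \<mu> h \<partial>posterior 0 h) \<partial>return histM (\<lambda>_. (0, 0)))"
        by (subst nn_integral_return)
           (simp_all add: measurable_nn_integral_posterior f posterior_0[of "\<lambda>_. (0, 0)"])
      finally show "(\<integral>\<^sup>+\<mu>. (\<integral>\<^sup>+h. f \<mu> h \<partial>hist \<mu> 0) \<partial>prior K m0 s0) = \<dots>" .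
    qed simp
  next
    case (Suc t)
    then obtain Q where Q [measurable_cong]: "sets Q = sets histM"
      and IH: "\<And>f. case_prod f \<in> borel_measurable (meansM \<Otimes>\<^sub>M histM) \<Longrightarrow>
      (\<integral>\<^sup>+\<mu>. (\<integral>\<^sup>+h. f \<mu> h \<partial>hist \<mu> t) \<partial>prior K m0 s0)
        = (\<integral>\<^sup>+h. (\<integral>\<^sup>+\<mu>. f \<mu> h \<partial>posterior t h) \<partial>Q)"
      by blast
    have step: "predictive_step t \<in> Q \<rightarrow>\<^sub>M subprob_algebra histM"
      using measurable_predictive_step by (simp cong: measurable_cong_sets add: Q)
    have spQ: "space Q \<noteq> {}"
      using sets_eq_imp_space_eq[OF Q] by simp
    \<comment> \<open>The history law advances by one predictive step.\<close>
    show ?case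
    proof (intro exI[of _ "Q \<bind> predictive_step t"] conjI allI impI)
      show "sets (Q \<bind> predictive_step t) = sets histM"
        by (rule sets_bind_measurable[OF step spQ])
      fix f :: "(nat \<Rightarrow> real) \<Rightarrow> (nat \<Rightarrow> nat \<times> real) \<Rightarrow> ennreal"
      assume f [measurable]: "case_prod f \<in> borel_measurable (meansM \<Otimes>\<^sub>M histM)"
      have "(\<integral>\<^sup>+\<mu>. (\<integral>\<^sup>+h. f \<mu> h \<partial>hist \<mu> (Suc t)) \<partial>prior K m0 s0)
          = (\<integral>\<^sup>+\<mu>. (\<integral>\<^sup>+h. (\<integral>\<^sup>+h'. f \<mu> h' \<partial>ts_step K m0 s0 sig \<mu> t h) \<partial>hist \<mu> t) \<partial>prior K m0 s0)"
      proof (rule nn_integral_cong)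
        fix \<mu> assume "\<mu> \<in> space (prior K m0 s0)"
        then have \<mu>: "\<mu> \<in> space meansM" by simp
        show "(\<integral>\<^sup>+h. f \<mu> h \<partial>hist \<mu> (Suc t))
          = (\<integral>\<^sup>+h. (\<integral>\<^sup>+h'. f \<mu> h' \<partial>ts_step K m0 s0 sig \<mu> t h) \<partial>hist \<mu> t)"
          unfolding ts_hist.simps using \<mu>
          by (intro nn_integral_bind[where B=histM])
             (simp_all add: measurable_ts_step_hist measurable_cong_sets[OF sets_hist[OF \<mu>] refl])
      qed
      \<comment> \<open>The hypothesis is used for the integral of \<open>f\<close> over one further
        round in place of \<open>f\<close>; this is why the claim ranges over all test
        functions.\<close>
      also have "\<dots> = (\<integral>\<^sup>+h. (\<integral>\<^sup>+\<mu>. (\<integral>\<^sup>+h'. f \<mu> h' \<partial>ts_step K m0 s0 sig \<mu> t h) \<partial>posterior t h) \<partial>Q)"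
        by (rule IH) (rule measurable_nn_integral_ts_step[OF f])
      also have "\<dots> = (\<integral>\<^sup>+h. (\<integral>\<^sup>+h'. (\<integral>\<^sup>+\<mu>. f \<mu> h' \<partial>posterior (Suc t) h') \<partial>predictive_step t h) \<partial>Q)"
        by (intro nn_integral_cong posterior_ts_step f)
      also have "\<dots> = (\<integral>\<^sup>+h. (\<integral>\<^sup>+\<mu>. f \<mu> h \<partial>posterior (Suc t) h) \<partial>(Q \<bind> predictive_step t))"
        by (rule nn_integral_bind[OF measurable_nn_integral_posterior[OF f] step, symmetric])
      finally show "(\<integral>\<^sup>+\<mu>. (\<integral>\<^sup>+h. f \<mu> h \<partial>hist \<mu> (Suc t)) \<partial>prior K m0 s0) = \<dots>" .
    qed
  qed
  then show ?thesis using that by blast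
qed

end

section \<open>Regret of a single Thompson sample\<close>

lemma ennreal_integral_le_nn_integral:
  fixes f :: "'a \<Rightarrow> real"
  shows "ennreal (integral\<^sup>L M f) \<le> (\<integral>\<^sup>+x. ennreal (f x) \<partial>M)"
proof (cases "integrable M f")
  case True
  then have int: "integrable M (\<lambda>x. max 0 (f x))" by simp
  have "ennreal (integral\<^sup>L M f) \<le> ennreal (\<integral>x. max 0 (f x) \<partial>M)"
    using True int by (intro ennreal_leI integral_mono) auto
  also have "\<dots> = (\<integral>\<^sup>+x. ennreal (max 0 (f x)) \<partial>M)"
    using int by (intro nn_integral_eq_integral[symmetric]) auto
  also have "\<dots> = (\<integral>\<^sup>+x. ennreal (f x) \<partial>M)"
    by (intro nn_integral_cong) (auto simp: max_def ennreal_neg)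
  finally show ?thesis .
qed (simp add: not_integrable_integral_eq)

text \<open>\<open>ennreal\<close> sends negative reals to 0, so the last term is the positive part
  of \<open>a - b\<close>.\<close>

lemma ennreal_le_plus_excess:
  "0 \<le> b \<Longrightarrow> ennreal a \<le> ennreal b + ennreal (a - b)"
  by (cases "a \<le> b") (auto simp: ennreal_plus[symmetric] ennreal_neg intro: ennreal_leI simp del: ennreal_plus)

text \<open>After the shift \<open>y = c + u\<close> by \<open>c = s * sqrt (2 * ln (1 / \<delta>))\<close>, the density at \<open>y\<close> is at most \<open>\<delta>\<close> times the density at \<open>u\<close>
  wherever the excess is positive, which leaves the absolute first moment.\<close>

lemma gauss_excess_le:
  assumes s: "0 < s" and \<delta>: "0 < \<delta>" "\<delta> \<le> 1"
  shows "(\<integral>\<^sup>+y. ennreal (y - m - s * sqrt (2 * ln (1 / \<delta>))) \<partial>gauss m s) \<le> ennreal (\<delta> * sqrt (2 * s\<^sup>2 / pi))"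
proof -
  define c where "c = s * sqrt (2 * ln (1 / \<delta>))"
  have L: "0 \<le> ln (1 / \<delta>)" using \<delta> by simp
  have c: "0 \<le> c" using s L by (simp add: c_def)
  \<comment> \<open>This choice of \<open>c\<close> makes the shift cost exactly
    \<open>exp (- ln (1 / \<delta>)) = \<delta>\<close>.\<close>
  have c2: "c\<^sup>2 / (2 * s\<^sup>2) = ln (1 / \<delta>)"
    using s L by (simp add: c_def power_mult_distrib)
  have dens: "normal_density m s (c + u) \<le> \<delta> * normal_density m s u" if u: "m \<le> u" for u
  proof -
    \<comment> \<open>The cross term \<open>2 * c * (u - m)\<close> is nonnegative and is
      dropped.\<close>
    have "c\<^sup>2 + (u - m)\<^sup>2 \<le> (c + u - m)\<^sup>2"
      using c u mult_nonneg_nonneg[of c "u - m"] by (simp add: power2_eq_square algebra_simps)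
    then have "(c\<^sup>2 + (u - m)\<^sup>2) / (2 * s\<^sup>2) \<le> (c + u - m)\<^sup>2 / (2 * s\<^sup>2)"
      using s by (intro divide_right_mono) auto
    then have "- (c + u - m)\<^sup>2 / (2 * s\<^sup>2) \<le> - ln (1 / \<delta>) + - (u - m)\<^sup>2 / (2 * s\<^sup>2)"
      by (simp add: add_divide_distrib c2)
    then have "exp (- (c + u - m)\<^sup>2 / (2 * s\<^sup>2)) \<le> exp (- ln (1 / \<delta>)) * exp (- (u - m)\<^sup>2 / (2 * s\<^sup>2))"
      by (simp only: exp_add[symmetric] exp_le_cancel_iff)
    also have "exp (- ln (1 / \<delta>)) = \<delta>"
      using \<delta> by (simp add: exp_minus)
    finally show ?thesis
      unfolding normal_density_def using s by (simp add: divide_right_mono)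
  qed
  have "(\<integral>\<^sup>+y. ennreal (y - m - c) \<partial>gauss m s)
      = (\<integral>\<^sup>+y. ennreal (normal_density m s y) * ennreal (y - m - c) \<partial>lborel)"
    by (rule nn_integral_gauss) simp
  also have "\<dots> = (\<integral>\<^sup>+u. ennreal (normal_density m s (c + u)) * ennreal (u - m) \<partial>lborel)"
    by (subst nn_integral_real_affine[where c=1 and t=c]) (simp_all add: algebra_simps)
  \<comment> \<open>For \<open>u < m\<close> the left side vanishes while the right side keeps its
    mass; the full absolute moment is where \<open>sqrt (2 / pi)\<close> comes from.\<close>
  also have "\<dots> \<le> (\<integral>\<^sup>+u. ennreal \<delta> * ennreal (normal_density m s u * \<bar>u - m\<bar>) \<partial>lborel)"
  proof (rule nn_integral_mono)
    fix u
    show "ennreal (normal_density m s (c + u)) * ennreal (u - m)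
        \<le> ennreal \<delta> * ennreal (normal_density m s u * \<bar>u - m\<bar>)"
    proof (cases "m \<le> u")
      case True
      then have "normal_density m s (c + u) * (u - m) \<le> (\<delta> * normal_density m s u) * (u - m)"
        by (intro mult_right_mono dens) auto
      then show ?thesis
        using True \<delta> by (simp add: ennreal_mult'[symmetric] mult.assoc ennreal_leI)
    qed (simp add: ennreal_neg)
  qed
  also have "\<dots> = ennreal \<delta> * (\<integral>\<^sup>+u. ennreal (normal_density m s u * \<bar>u - m\<bar>) \<partial>lborel)"
    by (rule nn_integral_cmult) simp
  also have "(\<integral>\<^sup>+u. ennreal (normal_density m s u * \<bar>u - m\<bar>) \<partial>lborel) = ennreal (s * sqrt (2 / pi))"
    using normal_moment_abs_odd[OF s, of m 0]
    by (subst nn_integral_eq_integral) (auto simp: has_bochner_integral_iff)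
  also have "s * sqrt (2 / pi) = sqrt (2 * s\<^sup>2 / pi)"
    using s by (simp add: real_sqrt_mult real_sqrt_divide)
  finally show ?thesis
    using \<delta> by (simp add: c_def ennreal_mult'[symmetric])
qed

lemma gauss_mean:
  assumes "0 < s"
  shows "integrable (gauss m s) (\<lambda>y. y)" "(\<integral>y. y \<partial>gauss m s) = m"
  using integrable_normal_moment_nz_1[OF assms, of m] integral_normal_moment_nz_1[OF assms, of m]
  by (simp_all add: gauss_def integrable_density integral_density)

text \<open>An arbitrary independent Gaussian vector without any history, so that the posterior of
  each fixed history is an instance.\<close>

locale gaussian_arms =
  fixes K :: nat and m s :: "nat \<Rightarrow> real"
  assumes K: "1 \<le> K" and s_pos: "\<And>i. i < K \<Longrightarrow> 0 < s i"
begin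

abbreviation P :: "(nat \<Rightarrow> real) measure" where
  "P \<equiv> PiM {..<K} (\<lambda>i. gauss (m i) (s i))"

abbreviation best where "best \<equiv> argmax_arm K"

sublocale P: prob_space P
  by (intro prob_space_PiM prob_space_gauss s_pos) simp

lemma measurable_P_component: "(\<lambda>v. v i) \<in> borel_measurable P"
  using measurable_PiM_component_total[of i "{..<K}"] by (simp cong: measurable_cong_sets)

lemma distr_P_component:
  assumes "i < K"
  shows "distr P borel (\<lambda>v. v i) = gauss (m i) (s i)"
proof -
  have "distr P borel (\<lambda>v. v i) = distr P (gauss (m i) (s i)) (\<lambda>v. v i)"
    by (rule distr_cong) simp_all
  also have "\<dots> = gauss (m i) (s i)"
    using assms by (intro distr_PiM_component prob_space_gauss s_pos) simp_all
  finally show ?thesis .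
qed

lemma nn_integral_P_component:
  assumes "i < K" and f: "f \<in> borel_measurable borel"
  shows "(\<integral>\<^sup>+v. f (v i) \<partial>P) = (\<integral>\<^sup>+y. f y \<partial>gauss (m i) (s i))"
  using assms by (subst distr_P_component[symmetric]) (simp_all add: nn_integral_distr)

lemma P_mean:
  assumes i: "i < K"
  shows "integrable P (\<lambda>v. v i)" "(\<integral>v. v i \<partial>P) = m i"
proof -
  note measurable_P_component[of i, measurable]
  show "integrable P (\<lambda>v. v i)"
    using gauss_mean(1)[OF s_pos[OF i], of "m i"] unfolding distr_P_component[OF i, symmetric]
    by (subst (asm) integrable_distr_eq) auto
  show "(\<integral>v. v i \<partial>P) = m i"
    using gauss_mean(2)[OF s_pos[OF i], of "m i"] unfolding distr_P_component[OF i, symmetric]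
    by (subst (asm) integral_distr) auto
qed

lemma measurable_best [measurable]: "best \<in> P \<rightarrow>\<^sub>M count_space UNIV"
  by simp

lemma measurable_value_best [measurable]: "(\<lambda>v. v (best v)) \<in> borel_measurable P"
  using measurable_PiM_eval[OF measurable_ident measurable_argmax_arm]
  by (simp cong: measurable_cong_sets)

lemma measurable_of_best [measurable]: "(\<lambda>v. g (best v)) \<in> borel_measurable P"
  by (rule measurable_compose[OF measurable_best]) simp

lemma integrable_value_best: "integrable P (\<lambda>v. v (best v))"
proof (rule Bochner_Integration.integrable_bound)
  show "integrable P (\<lambda>v. \<Sum>i<K. \<bar>v i\<bar>)"
    by (intro Bochner_Integration.integrable_sum integrable_abs P_mean) simp
  have "\<bar>v (best v)\<bar> \<le> (\<Sum>i<K. \<bar>v i\<bar>)" for v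
    using argmax_arm_less[OF K, of v] by (intro member_le_sum) auto
  then show "AE v in P. norm (v (best v)) \<le> norm (\<Sum>i<K. \<bar>v i\<bar>)"
    by (intro AE_I2) (simp add: sum_nonneg)
qed measurable

lemma integrable_mean_best: "integrable P (\<lambda>v. m (best v))"
proof (rule P.integrable_const_bound)
  have "\<bar>m (best v)\<bar> \<le> (\<Sum>i<K. \<bar>m i\<bar>)" for v
    using argmax_arm_less[OF K, of v] by (intro member_le_sum) auto
  then show "AE v in P. norm (m (best v)) \<le> (\<Sum>i<K. \<bar>m i\<bar>)"
    by simp
qed measurable

text \<open>Since \<open>\<mu>\<close> and \<open>v\<close> are independent copies, the sampled arm \<open>best v\<close> has the law of \<open>best \<mu>\<close>;
  in expectation the regret thus equals the gap between \<open>v\<close> and the means at the single arm \<open>best v\<close>.\<close>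

lemma sampled_regret_le:
  assumes \<delta>: "0 < \<delta>" "\<delta> \<le> 1"
  shows "(\<integral>\<^sup>+\<mu>. (\<integral>\<^sup>+v. ennreal (\<mu> (best \<mu>) - \<mu> (best v)) \<partial>P) \<partial>P)
    \<le> (\<integral>\<^sup>+v. ennreal (s (best v) * sqrt (2 * ln (1 / \<delta>))) \<partial>P)
      + ennreal (\<Sum>i<K. \<delta> * sqrt (2 * (s i)\<^sup>2 / pi))"
proof -
  let ?c = "sqrt (2 * ln (1 / \<delta>))"
  let ?E = "\<integral>\<mu>. \<mu> (best \<mu>) \<partial>P"
  have c: "0 \<le> ?c" using \<delta> by simp
  note less = argmax_arm_less[OF K]
  have below: "\<mu> i \<le> \<mu> (best \<mu>)" if "i < K" for \<mu> i
    using that by (subst argmax_arm_max[OF K, symmetric]) (intro Max_ge; simp)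
  \<comment> \<open>With the arm fixed, the gap is nonnegative, so \<open>ennreal\<close> cuts
    nothing off and the integral splits linearly.\<close>
  have inner: "(\<integral>\<^sup>+\<mu>. ennreal (\<mu> (best \<mu>) - \<mu> i) \<partial>P) = ennreal (?E - m i)"
    and inner_nonneg: "0 \<le> ?E - m i" if i: "i < K" for i
  proof -
    have int: "integrable P (\<lambda>\<mu>. \<mu> (best \<mu>) - \<mu> i)"
      by (intro Bochner_Integration.integrable_diff integrable_value_best P_mean i)
    have eq: "(\<integral>\<mu>. \<mu> (best \<mu>) - \<mu> i \<partial>P) = ?E - m i"
      by (subst Bochner_Integration.integral_diff) (simp_all add: P_mean i integrable_value_best)
    have nonneg: "0 \<le> \<mu> (best \<mu>) - \<mu> i" for \<mu> :: "nat \<Rightarrow> real"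
      using below[OF i, of \<mu>] by simp
    show "(\<integral>\<^sup>+\<mu>. ennreal (\<mu> (best \<mu>) - \<mu> i) \<partial>P) = ennreal (?E - m i)"
      unfolding eq[symmetric] by (rule nn_integral_eq_integral[OF int]) (simp only: nonneg AE_I2)
    show "0 \<le> ?E - m i"
      unfolding eq[symmetric] by (rule Bochner_Integration.integral_nonneg) (rule nonneg)
  qed
  have "(\<integral>\<^sup>+\<mu>. (\<integral>\<^sup>+v. ennreal (\<mu> (best \<mu>) - \<mu> (best v)) \<partial>P) \<partial>P)
      = (\<integral>\<^sup>+v. (\<integral>\<^sup>+\<mu>. ennreal (\<mu> (best \<mu>) - \<mu> (best v)) \<partial>P) \<partial>P)"
  proof (rule pair_sigma_finite.Fubini')
    show "pair_sigma_finite P P"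
      by (simp add: pair_sigma_finite_def P.sigma_finite_measure_axioms)
    let ?M = "PiM {..<K} (\<lambda>_. borel) \<Otimes>\<^sub>M PiM {..<K} (\<lambda>_. borel) :: ((nat \<Rightarrow> real) \<times> (nat \<Rightarrow> real)) measure"
    have "(\<lambda>p. snd p (best (snd p))) \<in> borel_measurable ?M" "(\<lambda>p. snd p (best (fst p))) \<in> borel_measurable ?M"
      by (rule measurable_PiM_eval[OF measurable_snd measurable_compose[OF _ measurable_argmax_arm]], simp)+
    then show "(\<lambda>(v, \<mu>). ennreal (\<mu> (best \<mu>) - \<mu> (best v))) \<in> borel_measurable (P \<Otimes>\<^sub>M P)"
      by (simp add: split_beta' cong: measurable_cong_sets)
  qed
  also have "\<dots> = (\<integral>\<^sup>+v. ennreal (?E - m (best v)) \<partial>P)"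
    by (simp add: inner less)
  also have "\<dots> = ennreal (\<integral>v. ?E - m (best v) \<partial>P)"
    using integrable_mean_best inner_nonneg[OF less] by (intro nn_integral_eq_integral) auto
  \<comment> \<open>\<open>?E\<close> is a constant, and it is also the integral of
    \<open>v (best v)\<close> under the same \<open>P\<close>: the maximum of the means is exchanged
    for the maximum of the sample.\<close>
  also have "(\<integral>v. ?E - m (best v) \<partial>P) = (\<integral>v. v (best v) - m (best v) \<partial>P)"
    using integrable_mean_best integrable_value_best P.prob_space by simp
  also have "ennreal \<dots> \<le> (\<integral>\<^sup>+v. ennreal (v (best v) - m (best v)) \<partial>P)"
    by (rule ennreal_integral_le_nn_integral)
  \<comment> \<open>The arm \<open>best v\<close> depends on all of \<open>v\<close>; bounding its
    excess by the sum over all arms leaves one-dimensional Gaussian integrals.\<close>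
  also have "\<dots> \<le> (\<integral>\<^sup>+v. ennreal (s (best v) * ?c) + (\<Sum>i<K. ennreal (v i - m i - s i * ?c)) \<partial>P)"
  proof (rule nn_integral_mono)
    fix v
    have "ennreal (v (best v) - m (best v))
        \<le> ennreal (s (best v) * ?c) + ennreal (v (best v) - m (best v) - s (best v) * ?c)"
      using c less_imp_le[OF s_pos[OF less]] by (intro ennreal_le_plus_excess mult_nonneg_nonneg)
    also have "\<dots> \<le> ennreal (s (best v) * ?c) + (\<Sum>i<K. ennreal (v i - m i - s i * ?c))"
      using less by (intro add_left_mono member_le_sum) auto
    finally show "ennreal (v (best v) - m (best v)) \<le> \<dots>" .
  qed
  also have "\<dots> = (\<integral>\<^sup>+v. ennreal (s (best v) * ?c) \<partial>P) + (\<Sum>i<K. \<integral>\<^sup>+v. ennreal (v i - m i - s i * ?c) \<partial>P)"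
  proof -
    have meas: "(\<lambda>v. ennreal (v i - m i - s i * ?c)) \<in> borel_measurable P" for i
    proof -
      note measurable_P_component[of i, measurable]
      show ?thesis by measurable
    qed
    show ?thesis
      using meas
      by (subst nn_integral_add) (auto intro!: borel_measurable_sum simp: nn_integral_sum)
  qed
  also have "(\<Sum>i<K. \<integral>\<^sup>+v. ennreal (v i - m i - s i * ?c) \<partial>P) \<le> (\<Sum>i<K. ennreal (\<delta> * sqrt (2 * (s i)\<^sup>2 / pi)))"
  proof (rule sum_mono)
    fix i assume "i \<in> {..<K}"
    then have i: "i < K" by simp
    have "(\<integral>\<^sup>+v. ennreal (v i - m i - s i * ?c) \<partial>P) = (\<integral>\<^sup>+y. ennreal (y - m i - s i * ?c) \<partial>gauss (m i) (s i))"
      by (rule nn_integral_P_component[OF i]) simp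
    also have "\<dots> \<le> ennreal (\<delta> * sqrt (2 * (s i)\<^sup>2 / pi))"
      by (rule gauss_excess_le[OF s_pos[OF i] \<delta>])
    finally show "(\<integral>\<^sup>+v. ennreal (v i - m i - s i * ?c) \<partial>P) \<le> \<dots>" .
  qed
  also have "(\<Sum>i<K. ennreal (\<delta> * sqrt (2 * (s i)\<^sup>2 / pi))) = ennreal (\<Sum>i<K. \<delta> * sqrt (2 * (s i)\<^sup>2 / pi))"
    using \<delta> by (intro sum_ennreal) simp
  finally show ?thesis
    by (simp add: add_left_mono)
qed

end

section \<open>Pathwise sum of the posterior widths\<close>

text \<open>Only rounds before \<open>t\<close> enter, so \<open>t = n\<close> is allowed; the width
  of the current round relies on this case.\<close>

lemma post_var_upd_past:
  assumes "t \<le> n"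
  shows "post_var s0 sig (h(n := y)) t i = post_var s0 sig h t i"
proof -
  have "real (npulls (h(n := y)) t i) = real (npulls h t i)"
    unfolding npulls_eq_sum using assms by (intro sum.cong) auto
  then show ?thesis by (simp add: post_var_def)
qed

text \<open>With \<open>u = s0\<^sup>2 / sig\<^sup>2\<close>, the posterior variance after \<open>N \<ge> 1\<close> pulls is \<open>sig\<^sup>2 * u / (1 + N * u)\<close>,
  which is at most the increment of \<open>sig\<^sup>2 * ln (1 + x * u)\<close> over \<open>[N - 1, N]\<close>;
  the first pull contributes \<open>s0\<^sup>2\<close>.\<close>

lemma log_increment_ge:
  fixes u :: real
  assumes u: "0 < u"
  shows "u / (1 + real (Suc N) * u) \<le> ln (1 + real (Suc N) * u) - ln (1 + real N * u)"
proof -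
  have pos: "0 < 1 + real N * u" "0 < 1 + real (Suc N) * u"
    using u by (simp_all add: add_pos_nonneg)
  have "ln ((1 + real N * u) / (1 + real (Suc N) * u)) \<le> (1 + real N * u) / (1 + real (Suc N) * u) - 1"
    using pos by (intro ln_le_minus_one divide_pos_pos)
  also have "\<dots> = - (u / (1 + real (Suc N) * u))"
    using pos by (simp add: field_simps)
  also have "ln ((1 + real N * u) / (1 + real (Suc N) * u)) = ln (1 + real N * u) - ln (1 + real (Suc N) * u)"
    using pos by (intro ln_divide_pos)
  finally show ?thesis by simp
qed

text \<open>Bounds the variances met at pull counts \<open>0, ..., N - 1\<close>. The last of these
  counts is \<open>N - 1\<close>, hence the predecessor in the logarithm.\<close>

definition variance_potential :: "real \<Rightarrow> real \<Rightarrow> nat \<Rightarrow> real" where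
  "variance_potential s \<sigma> N = (case N of 0 \<Rightarrow> 0 | Suc N' \<Rightarrow> s\<^sup>2 + \<sigma>\<^sup>2 * ln (1 + real N' * (s\<^sup>2 / \<sigma>\<^sup>2)))"

lemma variance_potential_step:
  assumes s: "0 < s" and \<sigma>: "0 < \<sigma>"
  shows "variance_potential s \<sigma> N + inverse (inverse (s\<^sup>2) + real N * inverse (\<sigma>\<^sup>2))
    \<le> variance_potential s \<sigma> (Suc N)"
proof (cases N)
  case 0
  then show ?thesis by (simp add: variance_potential_def)
next
  case (Suc N')
  define u where "u = s\<^sup>2 / \<sigma>\<^sup>2"
  have u: "0 < u" using s \<sigma> by (simp add: u_def)
  have s2: "s\<^sup>2 = \<sigma>\<^sup>2 * u" using \<sigma> by (simp add: u_def)
  have pos: "0 < 1 + real N * u" using u by (simp add: add_pos_nonneg)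
  have "inverse (s\<^sup>2) + real N * inverse (\<sigma>\<^sup>2) = (1 + real N * u) / (\<sigma>\<^sup>2 * u)"
    using u \<sigma> unfolding s2 by (simp add: field_simps)
  then have "inverse (inverse (s\<^sup>2) + real N * inverse (\<sigma>\<^sup>2)) = \<sigma>\<^sup>2 * (u / (1 + real N * u))"
    by simp
  also have "\<dots> \<le> \<sigma>\<^sup>2 * (ln (1 + real N * u) - ln (1 + real N' * u))"
    using log_increment_ge[OF u, of N'] by (intro mult_left_mono) (simp_all add: Suc)
  finally show ?thesis
    by (simp add: variance_potential_def Suc u_def[symmetric] algebra_simps)
qed

text \<open>Replaces the random pull count by the horizon. The two summands later yield the two
  square roots.\<close>

lemma variance_potential_le:
  assumes s: "0 < s" and \<sigma>: "0 < \<sigma>" and N: "N \<le> n"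
  shows "variance_potential s \<sigma> N \<le> s\<^sup>2 + \<sigma>\<^sup>2 * ln (1 + real n * s\<^sup>2 / \<sigma>\<^sup>2)"
proof (cases N)
  case 0
  then show ?thesis
    by (simp add: variance_potential_def ln_ge_zero)
next
  case (Suc N')
  have "ln (1 + real N' * (s\<^sup>2 / \<sigma>\<^sup>2)) \<le> ln (1 + real n * (s\<^sup>2 / \<sigma>\<^sup>2))"
    using N Suc by (intro ln_mono add_left_mono mult_right_mono add_pos_nonneg) auto
  then show ?thesis
    by (simp add: variance_potential_def Suc mult_left_mono)
qed

lemma npulls_Suc: "npulls h (Suc t) i = npulls h t i + (if fst (h t) = i then 1 else 0)"
proof -
  have "real (npulls h (Suc t) i) = real (npulls h t i + (if fst (h t) = i then 1 else 0))"
    by (simp add: npulls_eq_sum)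
  then show ?thesis by linarith
qed

lemma npulls_le: "npulls h t i \<le> t"
  by (induction t) (simp_all add: npulls_Suc npulls_def[of h 0])

text \<open>A round raises only the count of the pulled arm, whose potential grows by at least the
  variance of that round. The guard \<open>fst (h t) < K\<close> lets the bound hold for every
  history, not only for those that the algorithm produces.\<close>

lemma sum_post_var_le:
  assumes "\<And>i. i < K \<Longrightarrow> 0 < s0 i" "\<And>i. i < K \<Longrightarrow> 0 < sig i"
  shows "(\<Sum>t<n. if fst (h t) < K then post_var s0 sig h t (fst (h t)) else 0)
    \<le> (\<Sum>i<K. variance_potential (s0 i) (sig i) (npulls h n i))"
proof (induction n)
  case 0
  show ?case by (simp add: npulls_def variance_potential_def)
next
  case (Suc n)
  let ?g = "\<lambda>i. variance_potential (s0 i) (sig i)"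
  have "(if fst (h n) < K then post_var s0 sig h n (fst (h n)) else 0)
      = (\<Sum>i<K. if i = fst (h n) then post_var s0 sig h n i else 0)"
    by simp
  with Suc.IH have "(\<Sum>t<Suc n. if fst (h t) < K then post_var s0 sig h t (fst (h t)) else 0)
      \<le> (\<Sum>i<K. ?g i (npulls h n i) + (if i = fst (h n) then post_var s0 sig h n i else 0))"
    by (simp only: sum.lessThan_Suc sum.distrib add_mono order_refl)
  also have "\<dots> \<le> (\<Sum>i<K. ?g i (npulls h (Suc n) i))"
    using variance_potential_step assms
    by (intro sum_mono) (auto simp: npulls_Suc post_var_def)
  finally show ?case .
qed

text \<open>Cauchy-Schwarz against the constant sequence passes from standard deviations to
  variances at the price of a factor \<open>n\<close>; subadditivity of the square root then
  separates logarithms from prior variances.\<close>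

lemma sum_posterior_width_le:
  assumes "\<And>i. i < K \<Longrightarrow> 0 < s0 i" "\<And>i. i < K \<Longrightarrow> 0 < sig i" and L: "0 \<le> L"
  shows "(\<Sum>t<n. if fst (h t) < K then sqrt (post_var s0 sig h t (fst (h t))) * sqrt (2 * L) else 0)
    \<le> sqrt (2 * real n * L * (\<Sum>i<K. (sig i)\<^sup>2 * ln (1 + real n * (s0 i)\<^sup>2 / (sig i)\<^sup>2)))
      + sqrt (2 * real n * L * (\<Sum>i<K. (s0 i)\<^sup>2))"
proof -
  let ?w = "\<lambda>t. if fst (h t) < K then sqrt (post_var s0 sig h t (fst (h t))) * sqrt (2 * L) else 0"
  let ?A = "\<Sum>i<K. (sig i)\<^sup>2 * ln (1 + real n * (s0 i)\<^sup>2 / (sig i)\<^sup>2)" and ?B = "\<Sum>i<K. (s0 i)\<^sup>2"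
  have A: "0 \<le> ?A" by (intro sum_nonneg mult_nonneg_nonneg ln_ge_zero) auto
  have B: "0 \<le> ?B" by (intro sum_nonneg) auto
  have sq: "(?w t)\<^sup>2 = 2 * L * (if fst (h t) < K then post_var s0 sig h t (fst (h t)) else 0)" for t
    using L less_imp_le[OF post_var_pos[where i="fst (h t)" and h=h and sig=sig and t=t, OF assms(1)]]
    by (simp add: power_mult_distrib)
  have "(\<Sum>t<n. if fst (h t) < K then post_var s0 sig h t (fst (h t)) else 0)
      \<le> (\<Sum>i<K. variance_potential (s0 i) (sig i) (npulls h n i))"
    by (rule sum_post_var_le) (use assms in auto)
  also have "\<dots> \<le> (\<Sum>i<K. (s0 i)\<^sup>2 + (sig i)\<^sup>2 * ln (1 + real n * (s0 i)\<^sup>2 / (sig i)\<^sup>2))"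
    by (intro sum_mono variance_potential_le npulls_le) (use assms in auto)
  also have "\<dots> = ?A + ?B"
    by (simp add: sum.distrib)
  finally have total: "(\<Sum>t<n. if fst (h t) < K then post_var s0 sig h t (fst (h t)) else 0) \<le> ?A + ?B" .
  have "(\<Sum>t<n. ?w t)\<^sup>2 \<le> (\<Sum>t<n. (?w t)\<^sup>2) * real (card {..<n})"
    by (rule sum_squared_le_sum_of_squares)
  also have "\<dots> = 2 * real n * L * (\<Sum>t<n. if fst (h t) < K then post_var s0 sig h t (fst (h t)) else 0)"
    by (simp only: sq sum_distrib_left[symmetric] card_lessThan) simp
  also have "\<dots> \<le> 2 * real n * L * (?A + ?B)"
    using L total by (intro mult_left_mono) auto
  finally have "(\<Sum>t<n. ?w t) \<le> sqrt (2 * real n * L * (?A + ?B))"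
    by (rule real_le_rsqrt)
  also have "\<dots> = sqrt (2 * real n * L * ?A + 2 * real n * L * ?B)"
    by (simp only: distrib_left)
  also have "\<dots> \<le> sqrt (2 * real n * L * ?A) + sqrt (2 * real n * L * ?B)"
    using L A B by (intro sqrt_add_le_add_sqrt mult_nonneg_nonneg) auto
  finally show ?thesis .
qed

section \<open>Accumulated regret\<close>

context gaussian_thompson_sampling
begin

text \<open>Posterior variances never exceed prior ones, so the tail term has a bound independent of
  \<open>t\<close> and \<open>h\<close>, which \<open>n\<close> rounds simply multiply.\<close>

lemma posterior_regret_le:
  assumes \<delta>: "0 < \<delta>" "\<delta> \<le> 1"
  shows "(\<integral>\<^sup>+\<mu>. (\<integral>\<^sup>+v. ennreal (\<mu> (arm \<mu>) - \<mu> (arm v)) \<partial>posterior t h) \<partial>posterior t h)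
    \<le> (\<integral>\<^sup>+v. ennreal (sqrt (pvar h t (arm v)) * sqrt (2 * ln (1 / \<delta>))) \<partial>posterior t h)
      + ennreal (\<Sum>i<K. \<delta> * sqrt (2 * (s0 i)\<^sup>2 / pi))"
proof -
  interpret arms: gaussian_arms K "pmean h t" "\<lambda>i. sqrt (pvar h t i)"
    using K pvar_pos by unfold_locales auto
  have "(\<Sum>i<K. \<delta> * sqrt (2 * (sqrt (pvar h t i))\<^sup>2 / pi)) \<le> (\<Sum>i<K. \<delta> * sqrt (2 * (s0 i)\<^sup>2 / pi))"
    using \<delta> post_var_le_prior s0_pos less_imp_le[OF pvar_pos]
    by (intro sum_mono mult_left_mono real_sqrt_le_mono divide_right_mono) auto
  then show ?thesis
    by (intro order_trans[OF arms.sampled_regret_le[OF \<delta>]] add_left_mono ennreal_leI)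
qed

lemma prob_space_prior: "prob_space (prior K m0 s0)"
  unfolding prior_def by (intro prob_space_PiM prob_space_gauss s0_pos) simp

lemma emeasure_hist_le_1: "\<mu> \<in> space meansM \<Longrightarrow> emeasure (hist \<mu> t) (space (hist \<mu> t)) \<le> 1"
  by (rule subprob_space.subprob_emeasure_le_1[OF subprob_space_kernel[OF measurable_hist]])

definition expect :: "nat \<Rightarrow> ((nat \<Rightarrow> real) \<Rightarrow> (nat \<Rightarrow> nat \<times> real) \<Rightarrow> ennreal) \<Rightarrow> ennreal" where
  "expect t f = (\<integral>\<^sup>+\<mu>. (\<integral>\<^sup>+h. f \<mu> h \<partial>hist \<mu> t) \<partial>prior K m0 s0)"

lemma expect_mono: "(\<And>\<mu> h. f \<mu> h \<le> g \<mu> h) \<Longrightarrow> expect t f \<le> expect t g"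
  unfolding expect_def by (intro nn_integral_mono)

text \<open>An inequality, as \<open>hist\<close> enters only as a subprobability kernel; upper
  bounds ask for no more.\<close>

lemma expect_const_le: "expect t (\<lambda>_ _. c) \<le> c"
proof -
  interpret prob_space "prior K m0 s0" by (rule prob_space_prior)
  have "expect t (\<lambda>_ _. c) \<le> (\<integral>\<^sup>+\<mu>. c \<partial>prior K m0 s0)"
    unfolding expect_def
  proof (rule nn_integral_mono)
    fix \<mu> assume "\<mu> \<in> space (prior K m0 s0)"
    then show "(\<integral>\<^sup>+h. c \<partial>hist \<mu> t) \<le> c"
      using mult_left_mono[OF emeasure_hist_le_1[of \<mu> t], of c] by simp
  qed
  then show ?thesis by (simp add: emeasure_space_1[simplified])
qed

lemma expect_add:
  assumes f [measurable]: "case_prod f \<in> borel_measurable (meansM \<Otimes>\<^sub>M histM)"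
    and g [measurable]: "case_prod g \<in> borel_measurable (meansM \<Otimes>\<^sub>M histM)"
  shows "expect t (\<lambda>\<mu> h. f \<mu> h + g \<mu> h) = expect t f + expect t g"
proof -
  have "expect t (\<lambda>\<mu> h. f \<mu> h + g \<mu> h)
      = (\<integral>\<^sup>+\<mu>. (\<integral>\<^sup>+h. f \<mu> h \<partial>hist \<mu> t) + (\<integral>\<^sup>+h. g \<mu> h \<partial>hist \<mu> t) \<partial>prior K m0 s0)"
    unfolding expect_def
  proof (rule nn_integral_cong)
    fix \<mu> assume "\<mu> \<in> space (prior K m0 s0)"
    then have \<mu>: "\<mu> \<in> space meansM" by simp
    have "f \<mu> \<in> borel_measurable (hist \<mu> t)" "g \<mu> \<in> borel_measurable (hist \<mu> t)"
      using measurable_compose[OF measurable_Pair1'[OF \<mu>] f] measurable_compose[OF measurable_Pair1'[OF \<mu>] g]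
      by (simp_all add: measurable_cong_sets[OF sets_hist[OF \<mu>] refl])
    then show "(\<integral>\<^sup>+h. f \<mu> h + g \<mu> h \<partial>hist \<mu> t) = (\<integral>\<^sup>+h. f \<mu> h \<partial>hist \<mu> t) + (\<integral>\<^sup>+h. g \<mu> h \<partial>hist \<mu> t)"
      by (rule nn_integral_add)
  qed
  also have "\<dots> = expect t f + expect t g"
    unfolding expect_def
    by (intro nn_integral_add; subst measurable_cong_sets[OF sets_prior refl],
        rule nn_integral_measurable_subprob_algebra2[where N=histM]) (simp_all add: measurable_hist)
  finally show ?thesis .
qed

text \<open>Neither \<open>f\<close> nor \<open>g\<close> looks at round \<open>t\<close>, so the
  reward integrates out with mass 1 and the recorded arm becomes \<open>arm v\<close> with
  \<open>v\<close> drawn from the posterior.\<close>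

lemma expect_Suc:
  assumes f [measurable]: "case_prod f \<in> borel_measurable (meansM \<Otimes>\<^sub>M histM)"
    and g [measurable]: "\<And>i. (\<lambda>(\<mu>, h). g \<mu> h i) \<in> borel_measurable (meansM \<Otimes>\<^sub>M histM)"
    and f_past: "\<And>\<mu> h y. f \<mu> (h(t := y)) = f \<mu> h"
    and g_past: "\<And>\<mu> h y. g \<mu> (h(t := y)) = g \<mu> h"
  shows "expect (Suc t) (\<lambda>\<mu> h. f \<mu> h + g \<mu> h (fst (h t)))
    = expect t f + expect t (\<lambda>\<mu> h. \<integral>\<^sup>+v. g \<mu> h (arm v) \<partial>posterior t h)"
proof -
  have fg: "(\<lambda>(\<mu>, h). f \<mu> h + g \<mu> h (fst (h t))) \<in> borel_measurable (meansM \<Otimes>\<^sub>M histM)"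
  proof -
    have "(\<lambda>p. g (fst p) (snd p) (fst (snd p t))) \<in> borel_measurable (meansM \<Otimes>\<^sub>M histM)"
      by (rule measurable_compose_countable[OF _ measurable_hist_arm])
         (use g in \<open>simp_all add: split_beta'\<close>)
    then show ?thesis using f by (simp add: split_beta')
  qed
  have g_arm: "(\<lambda>p. g (fst (fst p)) (snd (fst p)) (arm (snd p)))
      \<in> borel_measurable ((meansM \<Otimes>\<^sub>M histM) \<Otimes>\<^sub>M meansM)"
  proof (rule measurable_compose_countable[where f="\<lambda>i p. g (fst (fst p)) (snd (fst p)) i"])
    fix i show "(\<lambda>p. g (fst (fst p)) (snd (fst p)) i) \<in> borel_measurable ((meansM \<Otimes>\<^sub>M histM) \<Otimes>\<^sub>M meansM)"
      using measurable_compose[OF measurable_fst g[of i]] by (simp add: split_beta')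
  qed simp
  have meas: "(\<lambda>(\<mu>, h). \<integral>\<^sup>+v. g \<mu> h (arm v) \<partial>posterior t h) \<in> borel_measurable (meansM \<Otimes>\<^sub>M histM)"
    unfolding split_beta'
    by (rule nn_integral_measurable_subprob_algebra2[where N=meansM])
       (use g_arm in \<open>simp_all add: split_beta'\<close>)
  have "expect (Suc t) (\<lambda>\<mu> h. f \<mu> h + g \<mu> h (fst (h t)))
      = expect t (\<lambda>\<mu> h. f \<mu> h + (\<integral>\<^sup>+v. g \<mu> h (arm v) \<partial>posterior t h))"
    unfolding expect_def
  proof (rule nn_integral_cong)
    fix \<mu> assume "\<mu> \<in> space (prior K m0 s0)"
    then have \<mu>: "\<mu> \<in> space meansM" by simp
    have "(\<lambda>h. f \<mu> h + g \<mu> h (fst (h t))) \<in> borel_measurable histM"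
      using measurable_compose[OF measurable_Pair1'[OF \<mu>] fg] by simp
    then have "(\<integral>\<^sup>+h. f \<mu> h + g \<mu> h (fst (h t)) \<partial>hist \<mu> (Suc t))
      = (\<integral>\<^sup>+h. (\<integral>\<^sup>+v. (\<integral>\<^sup>+x. f \<mu> h + g \<mu> h (arm v) \<partial>gauss (\<mu> (arm v)) (sig (arm v))) \<partial>posterior t h) \<partial>hist \<mu> t)"
      by (subst nn_integral_hist_Suc[OF _ \<mu>]) (simp_all add: f_past g_past)
    also have "\<dots> = (\<integral>\<^sup>+h. f \<mu> h + (\<integral>\<^sup>+v. g \<mu> h (arm v) \<partial>posterior t h) \<partial>hist \<mu> t)"
    proof (rule nn_integral_cong)
      fix h
      interpret P: prob_space "posterior t h" by (rule prob_space_posterior)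
      have gauss_1: "emeasure (gauss (\<mu> (arm v)) (sig (arm v))) UNIV = 1" for v
        using prob_space.emeasure_space_1[OF prob_space_gauss[OF sig_pos[OF arm_less]]] by simp
      have "(\<lambda>v. g \<mu> h (arm v)) \<in> borel_measurable (posterior t h)"
        by (rule measurable_compose[of arm _ "count_space UNIV"]) simp_all
      then show "(\<integral>\<^sup>+v. (\<integral>\<^sup>+x. f \<mu> h + g \<mu> h (arm v) \<partial>gauss (\<mu> (arm v)) (sig (arm v))) \<partial>posterior t h)
          = f \<mu> h + (\<integral>\<^sup>+v. g \<mu> h (arm v) \<partial>posterior t h)"
        using P.emeasure_space_1 by (simp add: gauss_1 nn_integral_add)
    qed
    finally show "(\<integral>\<^sup>+h. f \<mu> h + g \<mu> h (fst (h t)) \<partial>hist \<mu> (Suc t)) = \<dots>" .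
  qed
  also have "\<dots> = expect t f + expect t (\<lambda>\<mu> h. \<integral>\<^sup>+v. g \<mu> h (arm v) \<partial>posterior t h)"
    by (rule expect_add[OF f meas])
  finally show ?thesis .
qed

text \<open>\<open>arm\<close> applied to the true means is the optimal arm.\<close>

definition gap :: "(nat \<Rightarrow> real) \<Rightarrow> nat \<Rightarrow> ennreal" where
  "gap \<mu> i = ennreal (\<mu> (arm \<mu>) - \<mu> i)"

text \<open>The value 0 outside the arms matches the guard in \<open>sum_posterior_width_le\<close>,
  so the pathwise bound covers arbitrary histories.\<close>

definition width :: "real \<Rightarrow> (nat \<Rightarrow> nat \<times> real) \<Rightarrow> nat \<Rightarrow> nat \<Rightarrow> ennreal" where
  "width \<delta> h t i = ennreal (if i < K then sqrt (pvar h t i) * sqrt (2 * ln (1 / \<delta>)) else 0)"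

lemma width_upd_past: "t \<le> n \<Longrightarrow> width \<delta> (h(n := y)) t = width \<delta> h t"
  by (rule ext) (simp only: width_def post_var_upd_past)

lemma measurable_gap: "(\<lambda>\<mu>. gap \<mu> i) \<in> borel_measurable meansM"
proof -
  have "(\<lambda>\<mu>. \<mu> (arm \<mu>)) \<in> borel_measurable meansM"
    by (rule measurable_PiM_eval[OF measurable_ident_sets[OF refl] measurable_argmax_arm])
  from borel_measurable_diff[OF this measurable_PiM_component_total[of i]]
  show ?thesis
    unfolding gap_def by (rule measurable_compose[OF _ measurable_ennreal])
qed

text \<open>Bayes' theorem turns the means into a second posterior draw next to \<open>v\<close>,
  where the bound for a fixed history applies; the resulting width is then carried back.\<close>

lemma expect_round_regret_le:
  assumes \<delta>: "0 < \<delta>" "\<delta> \<le> 1"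
  shows "expect t (\<lambda>\<mu> h. \<integral>\<^sup>+v. gap \<mu> (arm v) \<partial>posterior t h)
    \<le> expect t (\<lambda>\<mu> h. \<integral>\<^sup>+v. width \<delta> h t (arm v) \<partial>posterior t h)
      + ennreal (\<Sum>i<K. \<delta> * sqrt (2 * (s0 i)\<^sup>2 / pi))"
proof -
  let ?b = "ennreal (\<Sum>i<K. \<delta> * sqrt (2 * (s0 i)\<^sup>2 / pi))"
  let ?W = "\<lambda>h. \<integral>\<^sup>+v. width \<delta> h t (arm v) \<partial>posterior t h"
  obtain Q where Q: "sets Q = sets histM"
    and disint: "\<And>f. case_prod f \<in> borel_measurable (meansM \<Otimes>\<^sub>M histM) \<Longrightarrow>
      expect t f = (\<integral>\<^sup>+h. (\<integral>\<^sup>+\<mu>. f \<mu> h \<partial>posterior t h) \<partial>Q)"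
    using posterior_disintegration[of t] unfolding expect_def by blast
  have gap_arm: "(\<lambda>p. gap (fst (fst p)) (arm (snd p))) \<in> borel_measurable ((meansM \<Otimes>\<^sub>M histM) \<Otimes>\<^sub>M meansM)"
  proof (rule measurable_compose_countable[where f="\<lambda>i p. gap (fst (fst p)) i"])
    fix i show "(\<lambda>p. gap (fst (fst p)) i) \<in> borel_measurable ((meansM \<Otimes>\<^sub>M histM) \<Otimes>\<^sub>M meansM)"
      by (rule measurable_compose[OF measurable_compose[OF measurable_fst measurable_fst] measurable_gap])
  qed simp
  have gap_meas: "(\<lambda>(\<mu>, h). \<integral>\<^sup>+v. gap \<mu> (arm v) \<partial>posterior t h) \<in> borel_measurable (meansM \<Otimes>\<^sub>M histM)"
    unfolding split_beta'
    by (rule nn_integral_measurable_subprob_algebra2[where N=meansM])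
       (use gap_arm in \<open>simp_all add: split_beta'\<close>)
  have width_arm: "(\<lambda>p. width \<delta> (fst p) t (arm (snd p))) \<in> borel_measurable (histM \<Otimes>\<^sub>M meansM)"
  proof (rule measurable_compose_countable[where f="\<lambda>i p. width \<delta> (fst p) t i"])
    fix i show "(\<lambda>p. width \<delta> (fst p) t i) \<in> borel_measurable (histM \<Otimes>\<^sub>M meansM)"
      unfolding width_def by (cases "i < K") simp_all
  qed simp
  have W: "?W \<in> borel_measurable histM"
    by (rule nn_integral_measurable_subprob_algebra2[where N=meansM])
       (use width_arm in \<open>simp_all add: split_beta'\<close>)
  have W': "(\<lambda>(\<mu>, h). ?W h) \<in> borel_measurable (meansM \<Otimes>\<^sub>M histM)"
    unfolding split_beta' by (rule measurable_compose[OF measurable_snd W])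
  have b: "(\<lambda>(\<mu>, h). ?b) \<in> borel_measurable (meansM \<Otimes>\<^sub>M histM)"
    unfolding split_beta' by (rule measurable_const) simp
  have W_b: "(\<lambda>(\<mu>, h). ?W h + ?b) \<in> borel_measurable (meansM \<Otimes>\<^sub>M histM)"
    using borel_measurable_add[OF W' b] unfolding split_beta' .
  have "expect t (\<lambda>\<mu> h. \<integral>\<^sup>+v. gap \<mu> (arm v) \<partial>posterior t h)
      = (\<integral>\<^sup>+h. (\<integral>\<^sup>+\<mu>. (\<integral>\<^sup>+v. gap \<mu> (arm v) \<partial>posterior t h) \<partial>posterior t h) \<partial>Q)"
    by (rule disint[OF gap_meas])
  also have "\<dots> \<le> (\<integral>\<^sup>+h. ?W h + ?b \<partial>Q)"
    unfolding gap_def width_def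
    by (intro nn_integral_mono) (simp only: arm_less if_True posterior_regret_le[OF \<delta>])
  \<comment> \<open>A vacuous integration over \<open>\<mu>\<close>, of total mass 1, gives the
    integrand the shape in which the disintegration can be reversed.\<close>
  also have "\<dots> = (\<integral>\<^sup>+h. (\<integral>\<^sup>+\<mu>. ?W h + ?b \<partial>posterior t h) \<partial>Q)"
    by (simp only: nn_integral_const prob_space.emeasure_space_1[OF prob_space_posterior] mult_1_right)
  also have "\<dots> = expect t (\<lambda>\<mu> h. ?W h + ?b)"
    by (rule disint[OF W_b, symmetric])
  also have "\<dots> = expect t (\<lambda>\<mu> h. ?W h) + expect t (\<lambda>_ _. ?b)"
    by (rule expect_add[OF W' b])
  also have "\<dots> \<le> expect t (\<lambda>\<mu> h. ?W h) + ?b"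
    by (intro add_left_mono expect_const_le)
  finally show ?thesis .
qed

text \<open>The widths stay inside the expectation: a single one need not shrink with
  \<open>t\<close>, since an arm not pulled so far keeps its prior variance, whereas their sum along
  a trajectory is controlled.\<close>

lemma expect_regret_le:
  assumes \<delta>: "0 < \<delta>" "\<delta> \<le> 1"
  shows "expect n (\<lambda>\<mu> h. \<Sum>t<n. gap \<mu> (fst (h t)))
    \<le> expect n (\<lambda>\<mu> h. \<Sum>t<n. width \<delta> h t (fst (h t)))
      + of_nat n * ennreal (\<Sum>i<K. \<delta> * sqrt (2 * (s0 i)\<^sup>2 / pi))"
proof (induction n)
  case 0
  show ?case by (simp add: expect_def)
next
  case (Suc n)
  let ?b = "ennreal (\<Sum>i<K. \<delta> * sqrt (2 * (s0 i)\<^sup>2 / pi))"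
  have gap_meas: "(\<lambda>(\<mu>, h). gap \<mu> i) \<in> borel_measurable (meansM \<Otimes>\<^sub>M histM)" for i
    using measurable_compose[OF measurable_fst measurable_gap[of i]] by (simp add: split_beta')
  have width_meas: "(\<lambda>(\<mu>, h). width \<delta> h t i) \<in> borel_measurable (meansM \<Otimes>\<^sub>M histM)" for t i
    unfolding width_def by (cases "i < K") simp_all
  have gap_sum: "(\<lambda>(\<mu>, h). \<Sum>t<n. gap \<mu> (fst (h t))) \<in> borel_measurable (meansM \<Otimes>\<^sub>M histM)"
  proof -
    have "(\<lambda>p. gap (fst p) (fst (snd p t))) \<in> borel_measurable (meansM \<Otimes>\<^sub>M histM)" for t
      by (rule measurable_compose_countable[where f="\<lambda>i p. gap (fst p) i"])
         (use gap_meas in \<open>simp_all add: split_beta' measurable_hist_arm\<close>)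
    then show ?thesis by (simp add: split_beta')
  qed
  have width_sum: "(\<lambda>(\<mu>, h). \<Sum>t<n. width \<delta> h t (fst (h t))) \<in> borel_measurable (meansM \<Otimes>\<^sub>M histM)"
  proof -
    have "(\<lambda>p. width \<delta> (snd p) t (fst (snd p t))) \<in> borel_measurable (meansM \<Otimes>\<^sub>M histM)" for t
      by (rule measurable_compose_countable[where f="\<lambda>i p. width \<delta> (snd p) t i"])
         (use width_meas in \<open>simp_all add: split_beta' measurable_hist_arm\<close>)
    then show ?thesis by (simp add: split_beta')
  qed
  have "expect (Suc n) (\<lambda>\<mu> h. \<Sum>t<Suc n. gap \<mu> (fst (h t)))
      = expect n (\<lambda>\<mu> h. \<Sum>t<n. gap \<mu> (fst (h t))) + expect n (\<lambda>\<mu> h. \<integral>\<^sup>+v. gap \<mu> (arm v) \<partial>posterior n h)"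
    unfolding sum.lessThan_Suc
    by (rule expect_Suc[where g="\<lambda>\<mu> h. gap \<mu>", OF gap_sum gap_meas])
       (rule sum.cong[OF refl], simp, rule refl)
  also have "\<dots> \<le> (expect n (\<lambda>\<mu> h. \<Sum>t<n. width \<delta> h t (fst (h t))) + of_nat n * ?b)
      + (expect n (\<lambda>\<mu> h. \<integral>\<^sup>+v. width \<delta> h n (arm v) \<partial>posterior n h) + ?b)"
    by (intro add_mono Suc.IH expect_round_regret_le \<delta>)
  also have "\<dots> = (expect n (\<lambda>\<mu> h. \<Sum>t<n. width \<delta> h t (fst (h t)))
      + expect n (\<lambda>\<mu> h. \<integral>\<^sup>+v. width \<delta> h n (arm v) \<partial>posterior n h)) + of_nat (Suc n) * ?b"
    by (simp only: of_nat_Suc distrib_right mult_1 ac_simps)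
  also have "expect n (\<lambda>\<mu> h. \<Sum>t<n. width \<delta> h t (fst (h t)))
      + expect n (\<lambda>\<mu> h. \<integral>\<^sup>+v. width \<delta> h n (arm v) \<partial>posterior n h)
      = expect (Suc n) (\<lambda>\<mu> h. \<Sum>t<Suc n. width \<delta> h t (fst (h t)))"
    unfolding sum.lessThan_Suc
    by (rule expect_Suc[where g="\<lambda>\<mu> h. width \<delta> h n", OF width_sum width_meas, symmetric])
       (rule sum.cong[OF refl], simp_all add: width_upd_past)
  finally show ?case .
qed

lemma bayes_regret_le_expect:
  "ennreal (bayes_regret K m0 s0 sig n) \<le> expect n (\<lambda>\<mu> h. \<Sum>t<n. gap \<mu> (fst (h t)))"
proof -
  let ?r = "\<lambda>\<mu> h. \<Sum>t<n. Max (\<mu> ` {..<K}) - \<mu> (fst (h t))"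
  \<comment> \<open>Subadditivity and not equality: on an arbitrary history an index beyond
    \<open>K\<close> may make a summand negative.\<close>
  have sum_le: "ennreal (\<Sum>t\<in>A. f t) \<le> (\<Sum>t\<in>A. ennreal (f t))" for f :: "nat \<Rightarrow> real" and A
  proof -
    have "ennreal (\<Sum>t\<in>A. f t) \<le> ennreal (\<Sum>t\<in>A. max 0 (f t))"
      by (intro ennreal_leI sum_mono) simp
    also have "\<dots> = (\<Sum>t\<in>A. ennreal (max 0 (f t)))"
      by (intro sum_ennreal[symmetric]) simp
    also have "\<dots> = (\<Sum>t\<in>A. ennreal (f t))"
      by (intro sum.cong) (auto simp: max_def ennreal_neg)
    finally show ?thesis .
  qed
  have "ennreal (bayes_regret K m0 s0 sig n) \<le> (\<integral>\<^sup>+\<mu>. ennreal (\<integral>h. ?r \<mu> h \<partial>hist \<mu> n) \<partial>prior K m0 s0)"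
    unfolding bayes_regret_def by (rule ennreal_integral_le_nn_integral)
  also have "\<dots> \<le> expect n (\<lambda>\<mu> h. ennreal (?r \<mu> h))"
    unfolding expect_def by (intro nn_integral_mono ennreal_integral_le_nn_integral)
  also have "\<dots> \<le> expect n (\<lambda>\<mu> h. \<Sum>t<n. gap \<mu> (fst (h t)))"
    unfolding gap_def argmax_arm_max[OF K] by (intro expect_mono sum_le)
  finally show ?thesis .
qed

lemma bayes_regret_le:
  assumes \<delta>: "0 < \<delta>" "\<delta> \<le> 1"
  shows "bayes_regret K m0 s0 sig n \<le>
      sqrt (2 * real n * ln (1 / \<delta>) * (\<Sum>i<K. (sig i)\<^sup>2 * ln (1 + real n * (s0 i)\<^sup>2 / (sig i)\<^sup>2)))
    + sqrt (2 * real n * ln (1 / \<delta>) * (\<Sum>i<K. (s0 i)\<^sup>2))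
    + real n * \<delta> * (\<Sum>i<K. sqrt (2 * (s0 i)\<^sup>2 / pi))"
proof -
  let ?B = "sqrt (2 * real n * ln (1 / \<delta>) * (\<Sum>i<K. (sig i)\<^sup>2 * ln (1 + real n * (s0 i)\<^sup>2 / (sig i)\<^sup>2)))
    + sqrt (2 * real n * ln (1 / \<delta>) * (\<Sum>i<K. (s0 i)\<^sup>2))"
  let ?b = "\<Sum>i<K. \<delta> * sqrt (2 * (s0 i)\<^sup>2 / pi)"
  have L: "0 \<le> ln (1 / \<delta>)" using \<delta> by simp
  have B: "0 \<le> ?B"
  proof -
    have "0 \<le> (\<Sum>i<K. (sig i)\<^sup>2 * ln (1 + real n * (s0 i)\<^sup>2 / (sig i)\<^sup>2))"
      by (intro sum_nonneg mult_nonneg_nonneg ln_ge_zero) auto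
    moreover have "0 \<le> (\<Sum>i<K. (s0 i)\<^sup>2)"
      by (intro sum_nonneg) simp
    ultimately show ?thesis
      using L by (intro add_nonneg_nonneg real_sqrt_ge_zero mult_nonneg_nonneg) simp_all
  qed
  have b: "0 \<le> ?b" using \<delta> by (intro sum_nonneg) auto
  have width_le: "(\<Sum>t<n. width \<delta> h t (fst (h t))) \<le> ennreal ?B" for h
  proof -
    have "(\<Sum>t<n. width \<delta> h t (fst (h t)))
      = ennreal (\<Sum>t<n. if fst (h t) < K then sqrt (pvar h t (fst (h t))) * sqrt (2 * ln (1 / \<delta>)) else 0)"
      unfolding width_def using L less_imp_le[OF pvar_pos]
      by (intro sum_ennreal) (auto intro!: mult_nonneg_nonneg)
    also have "\<dots> \<le> ennreal ?B"
      using L by (intro ennreal_leI sum_posterior_width_le s0_pos sig_pos)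
    finally show ?thesis .
  qed
  have "ennreal (bayes_regret K m0 s0 sig n) \<le> expect n (\<lambda>\<mu> h. \<Sum>t<n. gap \<mu> (fst (h t)))"
    by (rule bayes_regret_le_expect)
  also have "\<dots> \<le> expect n (\<lambda>\<mu> h. \<Sum>t<n. width \<delta> h t (fst (h t))) + of_nat n * ennreal ?b"
    by (rule expect_regret_le[OF \<delta>])
  also have "\<dots> \<le> ennreal ?B + of_nat n * ennreal ?b"
    by (intro add_right_mono order_trans[OF expect_mono expect_const_le] width_le)
  also have "\<dots> = ennreal (?B + real n * ?b)"
    using B b
    by (simp only: ennreal_of_nat_eq_real_of_nat ennreal_mult[symmetric] ennreal_plus[symmetric]
        of_nat_0_le_iff mult_nonneg_nonneg)
  finally have "bayes_regret K m0 s0 sig n \<le> ?B + real n * ?b"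
    using B b by (simp only: ennreal_le_iff add_nonneg_nonneg mult_nonneg_nonneg of_nat_0_le_iff)
  also have "real n * ?b = real n * \<delta> * (\<Sum>i<K. sqrt (2 * (s0 i)\<^sup>2 / pi))"
    by (simp add: sum_distrib_left mult.assoc)
  finally show ?thesis .
qed

end

theorem mainTheorem1:
  fixes K n :: nat and m0 s0 sig :: "nat \<Rightarrow> real" and \<delta> :: real
  assumes "K \<ge> 1"
    and "\<And>i. i < K \<Longrightarrow> s0 i > 0"
    and "\<And>i. i < K \<Longrightarrow> sig i > 0"
    and "n \<ge> 1"
    and "0 < \<delta>" and "\<delta> < 1"
  shows "bayes_regret K m0 s0 sig n \<le>
      sqrt (2 * real n * ln (1 / \<delta>) * (\<Sum>i<K. (sig i)\<^sup>2 * ln (1 + real n * (s0 i)\<^sup>2 / (sig i)\<^sup>2)))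
    + sqrt (2 * real n * ln (1 / \<delta>) * (\<Sum>i<K. (s0 i)\<^sup>2))
    + real n * \<delta> * (\<Sum>i<K. sqrt (2 * (s0 i)\<^sup>2 / pi))"
proof -
  interpret gaussian_thompson_sampling K m0 s0 sig
    using assms by unfold_locales auto
  show ?thesis
    using assms by (intro bayes_regret_le) auto
qed

end
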